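(* Let $G$ be a finite group, let $A$ be a separable C*-algebra, and let $\alpha$ and $\beta$ be actions of $G$ on $A$ with the Rokhlin property. Assume that $\alpha_g\sim_{\mathrm{au}}\beta_g$ for all $g\in G$. Then there exists an approximately inner automorphism $\psi$ of $A$ such that $\psi\circ\alpha_g=\beta_g\circ\psi$ for all $g\in G$.
   Context: For a C*-algebra $A$ (not necessarily unital), $\widetilde A$ is the C*-algebra obtained by adjoining a unit to $A$ (even if $A$ is unital). Two *-homomorphisms $\phi,\psi\colon A\to B$ are approximately unitarily equivalent, $\phi\sim_{\mathrm{au}}\psi$, if for every finite $F\subseteq A$ and $\varepsilon>0$ there is a unitary $u\in\widetilde B$ with $\|\phi(a)-u^*\psi(a)u\|<\varepsilon$ for all $a\in F$. An automorphism of $A$ is approximately inner if it is approximately unitarily equivalent to $\mathrm{id}_A$. Rokhlin property: an action $\alpha\colon G\to\mathrm{Aut}(A)$ of a finite group $G$ on a (not necessarily unital) C*-algebra $A$ has the Rokhlin property if for every $\varepsilon>0$ and every finite $F\subseteq A$ there exist mutually orthogonal positive contractions $r_g\in A$, $g\in G$, with $\|\alpha_g(r_h)-r_{gh}\|<\varepsilon$ for all $g,h\in G$; $\|r_ga-ar_g\|<\varepsilon$ for all $a\in F$, $g\in G$; and $\|(\sum_{g\in G}r_g)a-a\|<\varepsilon$ for all $a\in F$. *)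

theory Defs
  imports "HOL-Analysis.Analysis" "HOL-Algebra.Group"
begin

section \<open>C*-algebras\<close>

text \<open>
  Complex, not necessarily unital; the zero algebra is allowed. The law \<open>1 *\<^sub>C x = x\<close> is the case
  \<open>r = 1\<close> of \<open>scaleR_scaleC\<close>.
\<close>

class cstar_algebra = real_normed_algebra + banach +
  fixes scaleC :: "complex \<Rightarrow> 'a \<Rightarrow> 'a"  (infixr "*\<^sub>C" 75)
    and star :: "'a \<Rightarrow> 'a"
  assumes scaleR_scaleC: "scaleR r x = complex_of_real r *\<^sub>C x"
    and scaleC_add_right: "c *\<^sub>C (x + y) = c *\<^sub>C x + c *\<^sub>C y"
    and scaleC_add_left: "(c + d) *\<^sub>C x = c *\<^sub>C x + d *\<^sub>C x"
    and scaleC_scaleC: "c *\<^sub>C (d *\<^sub>C x) = (c * d) *\<^sub>C x"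
    and mult_scaleC_left: "(c *\<^sub>C x) * y = c *\<^sub>C (x * y)"
    and mult_scaleC_right: "x * (c *\<^sub>C y) = c *\<^sub>C (x * y)"
    and norm_scaleC: "norm (c *\<^sub>C x) = cmod c * norm x"
    and star_star: "star (star x) = x"
    and star_add: "star (x + y) = star x + star y"
    and star_scaleC: "star (c *\<^sub>C x) = cnj c *\<^sub>C star x"
    and star_mult: "star (x * y) = star y * star x"
    and cstar_identity: "norm (star x * x) = (norm x)\<^sup>2"

class cstar_algebra_1 = cstar_algebra + real_normed_algebra_1

lemma scaleC_one: "1 *\<^sub>C (x :: 'a::cstar_algebra) = x"
  by (metis scaleR_scaleC of_real_1 scaleR_one)

lemma scaleC_zero_left: "0 *\<^sub>C (x :: 'a::cstar_algebra) = 0"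
  by (metis scaleR_scaleC of_real_0 scaleR_zero_left)

lemma scaleC_zero_right: "c *\<^sub>C (0 :: 'a::cstar_algebra) = 0"
  by (metis scaleC_add_right add_cancel_right_right)

lemma scaleC_minus_left: "(- c) *\<^sub>C (x :: 'a::cstar_algebra) = - (c *\<^sub>C x)"
  by (metis add.right_inverse minus_unique scaleC_add_left scaleC_zero_left)

lemma scaleC_diff_left: "(c - d) *\<^sub>C (x :: 'a::cstar_algebra) = c *\<^sub>C x - d *\<^sub>C x"
  by (metis scaleC_add_left scaleC_minus_left uminus_add_conv_diff add.commute)

lemma star_zero: "star (0 :: 'a::cstar_algebra) = 0"
  by (metis star_add add_cancel_right_right)

lemma norm_star: "norm (star (x :: 'a::cstar_algebra)) = norm x"
proof -
  have le: "norm y \<le> norm (star y)" for y :: 'a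
  proof (cases "norm y = 0")
    case False
    have "norm y * norm y \<le> norm (star y) * norm y"
      by (metis cstar_identity norm_mult_ineq power2_eq_square)
    then show ?thesis using False by simp
  qed simp
  show ?thesis using le[of x] le[of "star x"] by (simp add: star_star)
qed

lemma bounded_linear_scaleC_right: "bounded_linear (\<lambda>x :: 'a::cstar_algebra. c *\<^sub>C x)"
proof (rule bounded_linear_intro[where K = "cmod c"])
  fix r and x :: 'a
  show "c *\<^sub>C (r *\<^sub>R x) = r *\<^sub>R (c *\<^sub>C x)"
    by (simp add: scaleR_scaleC scaleC_scaleC mult.commute)
qed (simp_all add: scaleC_add_right norm_scaleC mult.commute)


section \<open>Adjoining a unit\<close>

text \<open>
  \<open>Unitization a c\<close> stands for \<open>a + c 1\<close> with a new unit \<open>1\<close>, also if \<open>'a\<close> already has a unit.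
\<close>

datatype 'a unitization = Unitization (uni_alg: 'a) (uni_scal: complex)

abbreviation uni_embed :: "'a \<Rightarrow> 'a unitization"
  where "uni_embed a \<equiv> Unitization a 0"

definition left_mult :: "'a::cstar_algebra unitization \<Rightarrow> 'a \<Rightarrow> 'a"
  where "left_mult x b = uni_alg x * b + uni_scal x *\<^sub>C b"

text \<open>
  The norm is the operator norm of left multiplication on the original algebra. The first argument
  of the maximum only matters if the original algebra is unital (or zero): then left multiplication
  does not determine the scalar part.
\<close>

instantiation unitization :: (cstar_algebra) real_normed_algebra_1
begin

definition zero_unitization :: "'a unitization"
  where "0 = Unitization 0 0"

definition one_unitization :: "'a unitization"
  where "1 = Unitization 0 1"

definition plus_unitization :: "'a unitization \<Rightarrow> 'a unitization \<Rightarrow> 'a unitization"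
  where "x + y = Unitization (uni_alg x + uni_alg y) (uni_scal x + uni_scal y)"

definition minus_unitization :: "'a unitization \<Rightarrow> 'a unitization \<Rightarrow> 'a unitization"
  where "x - y = Unitization (uni_alg x - uni_alg y) (uni_scal x - uni_scal y)"

definition uminus_unitization :: "'a unitization \<Rightarrow> 'a unitization"
  where "- x = Unitization (- uni_alg x) (- uni_scal x)"

definition times_unitization :: "'a unitization \<Rightarrow> 'a unitization \<Rightarrow> 'a unitization"
  where "x * y = Unitization
    (uni_alg x * uni_alg y + uni_scal x *\<^sub>C uni_alg y + uni_scal y *\<^sub>C uni_alg x)
    (uni_scal x * uni_scal y)"

definition scaleR_unitization :: "real \<Rightarrow> 'a unitization \<Rightarrow> 'a unitization"
  where "r *\<^sub>R x = Unitization (r *\<^sub>R uni_alg x) (r *\<^sub>R uni_scal x)"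

definition norm_unitization :: "'a unitization \<Rightarrow> real"
  where "norm x = max (cmod (uni_scal x)) (onorm (left_mult x))"

definition sgn_unitization :: "'a unitization \<Rightarrow> 'a unitization"
  where "sgn x = inverse (norm x) *\<^sub>R (x :: 'a unitization)"

definition dist_unitization :: "'a unitization \<Rightarrow> 'a unitization \<Rightarrow> real"
  where "dist x y = norm (x - y :: 'a unitization)"

definition uniformity_unitization :: "('a unitization \<times> 'a unitization) filter"
  where "uniformity = (INF e\<in>{0<..}. principal {(x :: 'a unitization, y). dist x y < e})"

definition open_unitization :: "'a unitization set \<Rightarrow> bool"
  where "open U \<longleftrightarrow>
    (\<forall>x\<in>U. eventually (\<lambda>(x', y). x' = x \<longrightarrow> y \<in> U) (uniformity :: ('a unitization \<times> _) filter))"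

lemmas unitization_defs = zero_unitization_def one_unitization_def plus_unitization_def
  minus_unitization_def uminus_unitization_def times_unitization_def scaleR_unitization_def

lemma bounded_linear_left_mult: "bounded_linear (left_mult (x :: 'a unitization))"
  unfolding left_mult_def[abs_def]
  by (intro bounded_linear_add bounded_linear_mult_right bounded_linear_scaleC_right)

lemma left_mult_add: "left_mult (x + y) = (\<lambda>b. left_mult x b + left_mult (y :: 'a unitization) b)"
  by (simp add: fun_eq_iff left_mult_def unitization_defs scaleC_add_left algebra_simps)

lemma left_mult_times: "left_mult (x * y) = left_mult x \<circ> left_mult (y :: 'a unitization)"
  by (simp add: fun_eq_iff left_mult_def unitization_defs scaleC_scaleC scaleC_add_right
      mult_scaleC_left mult_scaleC_right algebra_simps)

lemma norm_left_mult_le: "norm (left_mult x b) \<le> norm (x :: 'a unitization) * norm b"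
proof -
  have "norm (left_mult x b) \<le> onorm (left_mult x) * norm b"
    by (rule onorm[OF bounded_linear_left_mult])
  also have "\<dots> \<le> norm x * norm b"
    by (intro mult_right_mono) (auto simp: norm_unitization_def)
  finally show ?thesis .
qed

lemma norm_uni_embed: "norm (uni_embed a :: 'a unitization) = norm a"
proof -
  have "onorm (left_mult (uni_embed a)) \<le> norm a"
    by (rule onorm_bound) (auto simp: left_mult_def scaleC_zero_left norm_mult_ineq)
  then have 1: "norm (uni_embed a :: 'a unitization) \<le> norm a"
    by (simp add: norm_unitization_def)
  have "norm (left_mult (uni_embed a) (star a)) = norm a * norm a"
    using cstar_identity[of "star a"]
    by (simp add: left_mult_def scaleC_zero_left star_star norm_star power2_eq_square)
  then have "norm a * norm a \<le> norm (uni_embed a :: 'a unitization) * norm a"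
    using norm_left_mult_le[of "uni_embed a" "star a"] by (simp add: norm_star)
  then have "norm a \<le> norm (uni_embed a :: 'a unitization)"
    by (cases "norm a = 0")
      (auto simp: norm_unitization_def le_max_iff_disj)
  with 1 show ?thesis by simp
qed

lemma cmod_uni_scal_le: "cmod (uni_scal x) \<le> norm (x :: 'a unitization)"
  by (simp add: norm_unitization_def)

lemma norm_unitization_triangle: "norm (x + y) \<le> norm x + norm (y :: 'a unitization)"
proof -
  have "onorm (left_mult (x + y)) \<le> onorm (left_mult x) + onorm (left_mult y)"
    unfolding left_mult_add by (intro onorm_triangle bounded_linear_left_mult)
  moreover have "cmod (uni_scal (x + y)) \<le> cmod (uni_scal x) + cmod (uni_scal y)"
    by (simp add: unitization_defs norm_triangle_ineq)
  ultimately show ?thesis by (auto simp: norm_unitization_def)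
qed

lemma norm_unitization_mult: "norm (x * y) \<le> norm x * norm (y :: 'a unitization)"
proof -
  have "onorm (left_mult (x * y)) \<le> onorm (left_mult x) * onorm (left_mult y)"
    unfolding left_mult_times by (intro onorm_compose bounded_linear_left_mult)
  also have "\<dots> \<le> norm x * norm y"
    by (intro mult_mono onorm_pos_le bounded_linear_left_mult)
      (auto simp: norm_unitization_def le_max_iff_disj)
  finally have 1: "onorm (left_mult (x * y)) \<le> norm x * norm y" .
  have "cmod (uni_scal (x * y)) = cmod (uni_scal x) * cmod (uni_scal y)"
    by (simp add: unitization_defs norm_mult)
  also have "\<dots> \<le> norm x * norm y"
    by (intro mult_mono cmod_uni_scal_le) (auto simp: norm_unitization_def le_max_iff_disj)
  finally show ?thesis using 1 by (simp add: norm_unitization_def)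
qed

lemma norm_unitization_ge_0: "0 \<le> norm (x :: 'a unitization)"
  using cmod_uni_scal_le norm_ge_zero order_trans by blast

lemma norm_unitization_eq_0: "norm (x :: 'a unitization) = 0 \<longleftrightarrow> x = 0"
proof
  assume 0: "norm x = 0"
  then have s: "uni_scal x = 0"
    using cmod_uni_scal_le[of x] by simp
  then have "x = uni_embed (uni_alg x)" by (cases x) simp
  then have "norm (uni_alg x) = 0" using 0 norm_uni_embed by metis
  with s show "x = 0" by (cases x) (simp add: unitization_defs)
next
  assume "x = 0"
  then show "norm x = 0" using norm_uni_embed[of 0] by (simp add: zero_unitization_def)
qed

lemma left_mult_scaleR: "left_mult (r *\<^sub>R x) = (\<lambda>b. r *\<^sub>R left_mult (x :: 'a unitization) b)"
  by (simp add: fun_eq_iff left_mult_def unitization_defs scaleR_scaleC scaleC_scaleC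
      scaleC_add_right mult_scaleC_left flip: scaleR_conv_of_real)

instance
proof
  fix x y z :: "'a unitization" and r s :: real
  show "x - y = x + - y" "x + y + z = x + (y + z)" "0 + x = x" "- x + x = 0" "x + y = y + x"
    by (simp_all add: unitization_defs)
  show "r *\<^sub>R (x + y) = r *\<^sub>R x + r *\<^sub>R y" "(r + s) *\<^sub>R x = r *\<^sub>R x + s *\<^sub>R x"
    "r *\<^sub>R s *\<^sub>R x = (r * s) *\<^sub>R x" "1 *\<^sub>R x = x"
    by (simp_all add: unitization_defs algebra_simps)
  show "x * y * z = x * (y * z)" "(x + y) * z = x * z + y * z" "x * (y + z) = x * y + x * z"
    by (simp_all add: unitization_defs scaleC_scaleC scaleC_add_right scaleC_add_left
        mult_scaleC_left mult_scaleC_right algebra_simps)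
  show "1 * x = x" "x * 1 = x" "(0 :: 'a unitization) \<noteq> 1"
    by (simp_all add: unitization_defs scaleC_one scaleC_zero_right)
  show "r *\<^sub>R x * y = r *\<^sub>R (x * y)" "x * r *\<^sub>R y = r *\<^sub>R (x * y)"
    by (simp_all add: unitization_defs scaleR_scaleC scaleC_scaleC scaleC_add_right
        mult_scaleC_left mult_scaleC_right scaleR_conv_of_real mult_ac)
  show "norm (r *\<^sub>R x) = \<bar>r\<bar> * norm x"
    by (simp add: norm_unitization_def left_mult_scaleR onorm_scaleR[OF bounded_linear_left_mult]
        max_mult_distrib_left) (simp add: unitization_defs norm_mult)
  show "norm (1 :: 'a unitization) = 1"
    by (simp add: norm_unitization_def left_mult_def[abs_def] one_unitization_def scaleC_one
        onorm_id_le max_def order_antisym)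
qed (simp_all add: sgn_unitization_def dist_unitization_def uniformity_unitization_def
    open_unitization_def norm_unitization_triangle norm_unitization_mult norm_unitization_eq_0)

end

lemma norm_unitization_le:
  "norm (x :: 'a::cstar_algebra unitization) \<le> norm (uni_alg x) + cmod (uni_scal x)"
proof -
  have "onorm (left_mult (Unitization (0 :: 'a) c)) \<le> cmod c" for c
    by (rule onorm_bound) (auto simp: left_mult_def norm_scaleC)
  then have c: "norm (Unitization (0 :: 'a) c) \<le> cmod c" for c
    by (simp add: norm_unitization_def)
  have "x = uni_embed (uni_alg x) + Unitization 0 (uni_scal x)"
    by (cases x) (simp add: unitization_defs)
  then have "norm x \<le> norm (uni_embed (uni_alg x)) + norm (Unitization (0 :: 'a) (uni_scal x))"
    by (metis norm_triangle_ineq)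
  with c[of "uni_scal x"] show ?thesis by (simp add: norm_uni_embed)
qed

lemma bounded_linear_uni_scal: "bounded_linear (uni_scal :: 'a::cstar_algebra unitization \<Rightarrow> _)"
  by (rule bounded_linear_intro[where K = 1]) (simp_all add: unitization_defs cmod_uni_scal_le)

lemma bounded_linear_uni_alg: "bounded_linear (uni_alg :: 'a::cstar_algebra unitization \<Rightarrow> _)"
proof (rule bounded_linear_intro[where K = 2])
  fix x :: "'a unitization"
  have *: "norm (Unitization (0 :: 'a) (uni_scal x)) \<le> norm x"
    using norm_unitization_le[of "Unitization (0 :: 'a) (uni_scal x)"] cmod_uni_scal_le[of x]
    by simp
  have "uni_embed (uni_alg x) = x - Unitization 0 (uni_scal x)"
    by (simp add: unitization_defs)
  then have "norm (uni_alg x) \<le> norm x + norm (Unitization (0 :: 'a) (uni_scal x))"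
    by (metis norm_triangle_ineq4 norm_uni_embed)
  with * show "norm (uni_alg x) \<le> norm x * 2" by simp
qed (simp_all add: unitization_defs)

instance unitization :: (cstar_algebra) banach
proof
  fix X :: "nat \<Rightarrow> 'a unitization"
  assume X: "Cauchy X"
  obtain a where a: "(\<lambda>n. uni_alg (X n)) \<longlonglongrightarrow> a"
    using bounded_linear.Cauchy[OF bounded_linear_uni_alg X] Cauchy_convergent_iff convergent_def
    by blast
  obtain c where c: "(\<lambda>n. uni_scal (X n)) \<longlonglongrightarrow> c"
    using bounded_linear.Cauchy[OF bounded_linear_uni_scal X] Cauchy_convergent_iff convergent_def
    by blast
  have "(\<lambda>n. norm (uni_alg (X n) - a) + cmod (uni_scal (X n) - c)) \<longlonglongrightarrow> 0"
    using tendsto_add[OF tendsto_norm_zero[OF LIM_zero[OF a]] tendsto_norm_zero[OF LIM_zero[OF c]]]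
    by simp
  then have "(\<lambda>n. X n - Unitization a c) \<longlonglongrightarrow> 0"
  proof (rule Lim_null_comparison[rotated])
    show "\<forall>\<^sub>F n in sequentially. norm (X n - Unitization a c)
        \<le> norm (uni_alg (X n) - a) + cmod (uni_scal (X n) - c)"
      using norm_unitization_le[of "X _ - Unitization a c"]
      by (simp add: minus_unitization_def)
  qed
  then show "convergent X" using LIM_zero_cancel convergent_def by blast
qed

instantiation unitization :: (cstar_algebra) cstar_algebra_1
begin

definition scaleC_unitization :: "complex \<Rightarrow> 'a unitization \<Rightarrow> 'a unitization"
  where "c *\<^sub>C x = Unitization (c *\<^sub>C uni_alg x) (c * uni_scal x)"

definition star_unitization :: "'a unitization \<Rightarrow> 'a unitization"
  where "star x = Unitization (star (uni_alg x)) (cnj (uni_scal x))"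

lemmas unitization_star_defs = unitization_defs scaleC_unitization_def star_unitization_def

lemma left_mult_scaleC: "left_mult (c *\<^sub>C x) = (\<lambda>b. c *\<^sub>C left_mult (x :: 'a unitization) b)"
  by (simp add: fun_eq_iff left_mult_def unitization_star_defs scaleC_scaleC scaleC_add_right
      mult_scaleC_left)

lemma left_mult_star: "star (left_mult x b) * c = star b * left_mult (star x) (c :: 'a)"
  by (simp add: left_mult_def unitization_star_defs star_add star_mult star_scaleC
      mult_scaleC_left mult_scaleC_right algebra_simps)

lemma norm_unitization_scaleC: "norm (c *\<^sub>C x) = cmod c * norm (x :: 'a unitization)"
proof -
  have le: "norm (d *\<^sub>C y) \<le> cmod d * norm y" for d and y :: "'a unitization"
  proof -
    have "onorm (left_mult (d *\<^sub>C y)) \<le> cmod d * norm y"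
      unfolding left_mult_scaleC
    proof (rule onorm_bound)
      show "norm (d *\<^sub>C left_mult y b) \<le> cmod d * norm y * norm b" for b
        using mult_left_mono[OF norm_left_mult_le[of y b], of "cmod d"]
        by (simp add: norm_scaleC algebra_simps)
    qed (simp add: norm_unitization_def le_max_iff_disj)
    moreover have "cmod (uni_scal (d *\<^sub>C y)) \<le> cmod d * norm y"
      by (simp add: unitization_star_defs norm_mult mult_left_mono cmod_uni_scal_le)
    ultimately show ?thesis by (simp add: norm_unitization_def)
  qed
  show ?thesis
  proof (cases "c = 0")
    case True
    then show ?thesis using le[of 0 x] cmod_uni_scal_le[of "0 *\<^sub>C x"]
      by (metis norm_ge_zero norm_zero mult_zero_left order_antisym order_trans)
  next
    case False
    have "x = inverse c *\<^sub>C (c *\<^sub>C x)"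
      using False by (cases x) (simp add: unitization_star_defs scaleC_scaleC scaleC_one)
    then have "norm x \<le> cmod (inverse c) * norm (c *\<^sub>C x)"
      using le[of "inverse c" "c *\<^sub>C x"] by simp
    then have "cmod c * norm x \<le> norm (c *\<^sub>C x)"
      using False by (simp add: norm_divide field_simps)
    with le[of c x] show ?thesis by simp
  qed
qed

lemma cstar_unitization_le: "(norm x)\<^sup>2 \<le> norm (star x * (x :: 'a unitization))"
proof -
  let ?N = "norm (star x * x)"
  have N0: "0 \<le> ?N" by (rule norm_unitization_ge_0)
  have "(cmod (uni_scal x))\<^sup>2 = cmod (uni_scal (star x * x))"
    by (simp add: unitization_star_defs norm_mult power2_eq_square)
  then have "(cmod (uni_scal x))\<^sup>2 \<le> ?N"
    using cmod_uni_scal_le by metis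
  then have 1: "cmod (uni_scal x) \<le> sqrt ?N"
    by (simp add: real_le_rsqrt)
  have "onorm (left_mult x) \<le> sqrt ?N"
  proof (rule onorm_bound)
    fix b :: 'a
    have "(norm (left_mult x b))\<^sup>2 = norm (star b * left_mult (star x * x) b)"
      by (simp flip: cstar_identity add: left_mult_star left_mult_times)
    also have "\<dots> \<le> norm b * norm (left_mult (star x * x) b)"
      using norm_mult_ineq[of "star b"] by (simp add: norm_star)
    also have "\<dots> \<le> norm b * (?N * norm b)"
      by (intro mult_left_mono norm_left_mult_le) simp
    finally have "(norm (left_mult x b))\<^sup>2 \<le> ?N * (norm b)\<^sup>2"
      by (simp add: power2_eq_square algebra_simps)
    then have "norm (left_mult x b) \<le> sqrt (?N * (norm b)\<^sup>2)"
      by (rule real_le_rsqrt)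
    then show "norm (left_mult x b) \<le> sqrt ?N * norm b"
      by (simp add: real_sqrt_mult)
  qed (simp add: N0)
  with 1 have "norm x \<le> sqrt ?N" by (simp add: norm_unitization_def)
  then show ?thesis
    using norm_unitization_ge_0[of x] N0 by (metis power_mono real_sqrt_pow2)
qed

lemma star_unitization_star: "star (star x) = (x :: 'a unitization)"
  by (cases x) (simp add: unitization_star_defs star_star)

lemma norm_unitization_star: "norm (star x) = norm (x :: 'a unitization)"
proof -
  have le: "norm y \<le> norm (star y)" for y :: "'a unitization"
  proof (cases "norm y = 0")
    case True
    then show ?thesis using norm_unitization_ge_0 by metis
  next
    case False
    have "norm y * norm y \<le> norm (star y) * norm y"
      using cstar_unitization_le norm_unitization_mult order_trans
      by (metis power2_eq_square)
    then show ?thesis using False norm_unitization_ge_0[of y] by simp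
  qed
  show ?thesis using le[of x] le[of "star x"] by (simp add: star_unitization_star)
qed

instance
proof
  fix x y :: "'a unitization" and c d :: complex and r :: real
  show "r *\<^sub>R x = complex_of_real r *\<^sub>C x"
    by (simp add: unitization_star_defs scaleR_scaleC scaleR_conv_of_real)
  show "c *\<^sub>C (x + y) = c *\<^sub>C x + c *\<^sub>C y" "(c + d) *\<^sub>C x = c *\<^sub>C x + d *\<^sub>C x"
    "c *\<^sub>C d *\<^sub>C x = (c * d) *\<^sub>C x"
    by (simp_all add: unitization_star_defs scaleC_scaleC scaleC_add_right scaleC_add_left
        algebra_simps)
  show "c *\<^sub>C x * y = c *\<^sub>C (x * y)" "x * c *\<^sub>C y = c *\<^sub>C (x * y)"
    by (simp_all add: unitization_star_defs scaleC_scaleC scaleC_add_right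
        mult_scaleC_left mult_scaleC_right mult_ac)
  show "star (x + y) = star x + star y" "star (c *\<^sub>C x) = cnj c *\<^sub>C star x"
    "star (x * y) = star y * star x"
    by (simp_all add: unitization_star_defs star_add star_scaleC star_mult algebra_simps)
  have "norm (star x * x) \<le> (norm x)\<^sup>2"
    using norm_unitization_mult[of "star x" x]
    by (simp add: norm_unitization_star power2_eq_square)
  with cstar_unitization_le[of x] show "norm (star x * x) = (norm x)\<^sup>2" by simp
qed (simp_all add: norm_unitization_scaleC star_unitization_star)

end


section \<open>Automorphisms, approximate unitary equivalence and the Rokhlin property\<close>

definition unitary :: "'a::cstar_algebra_1 \<Rightarrow> bool"
  where "unitary u \<longleftrightarrow> star u * u = 1 \<and> u * star u = 1"

text \<open>
  The spectrum of \<open>a\<close> is taken in the algebra with adjoined unit (so it always contains \<open>0\<close>).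
\<close>

definition spectrum :: "'a::cstar_algebra \<Rightarrow> complex set"
  where "spectrum a = {c. \<nexists>y. (uni_embed a - c *\<^sub>C 1) * y = 1 \<and> y * (uni_embed a - c *\<^sub>C 1) = 1}"

definition positive :: "'a::cstar_algebra \<Rightarrow> bool"
  where "positive a \<longleftrightarrow> star a = a \<and> spectrum a \<subseteq> complex_of_real ` {0..}"

definition star_hom :: "('a::cstar_algebra \<Rightarrow> 'b::cstar_algebra) \<Rightarrow> bool"
  where "star_hom \<phi> \<longleftrightarrow>
    (\<forall>x y. \<phi> (x + y) = \<phi> x + \<phi> y) \<and>
    (\<forall>c x. \<phi> (c *\<^sub>C x) = c *\<^sub>C \<phi> x) \<and>
    (\<forall>x y. \<phi> (x * y) = \<phi> x * \<phi> y) \<and>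
    (\<forall>x. \<phi> (star x) = star (\<phi> x))"

definition Aut :: "('a::cstar_algebra \<Rightarrow> 'a) monoid"
  where "Aut = \<lparr>carrier = {\<phi>. star_hom \<phi> \<and> bij \<phi>}, mult = (\<circ>), one = id\<rparr>"

lemma group_Aut: "group (Aut :: ('a::cstar_algebra \<Rightarrow> 'a) monoid)"
proof (rule groupI)
  fix \<phi> :: "'a \<Rightarrow> 'a"
  assume "\<phi> \<in> carrier Aut"
  then have h: "star_hom \<phi>" and b: "bij \<phi>" by (auto simp: Aut_def)
  have f: "\<phi> (inv_into UNIV \<phi> y) = y" for y using b by (simp add: bij_is_surj surj_f_inv_f)
  have i: "inv_into UNIV \<phi> z = w" if "z = \<phi> w" for z w using b that by (simp add: bij_is_inj)
  have "star_hom (inv_into UNIV \<phi>)"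
    using h unfolding star_hom_def by (intro conjI allI i) (simp_all add: f)
  then show "\<exists>\<psi>\<in>carrier Aut. \<psi> \<otimes>\<^bsub>Aut\<^esub> \<phi> = \<one>\<^bsub>Aut\<^esub>"
    using b by (intro bexI[of _ "inv_into UNIV \<phi>"])
      (auto simp: Aut_def bij_imp_bij_inv bij_is_inj)
qed (auto simp: Aut_def star_hom_def bij_comp o_assoc)

definition approx_unitarily_equiv ::
    "('a::cstar_algebra \<Rightarrow> 'b::cstar_algebra) \<Rightarrow> ('a \<Rightarrow> 'b) \<Rightarrow> bool"  (infix "\<sim>\<^sub>a\<^sub>u" 50)
  where "\<phi> \<sim>\<^sub>a\<^sub>u \<psi> \<longleftrightarrow>
    (\<forall>F \<epsilon>. finite F \<and> \<epsilon> > 0 \<longrightarrow>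
      (\<exists>u. unitary u \<and>
        (\<forall>a\<in>F. norm (uni_embed (\<phi> a) - star u * uni_embed (\<psi> a) * u) < \<epsilon>)))"

definition approx_inner :: "('a::cstar_algebra \<Rightarrow> 'a) \<Rightarrow> bool"
  where "approx_inner \<phi> \<longleftrightarrow> \<phi> \<sim>\<^sub>a\<^sub>u id"

text \<open>An action of \<open>G\<close> on the C*-algebra \<open>'a\<close> is an element of \<open>hom G Aut\<close>.\<close>

definition Rokhlin_property :: "('g, 'm) monoid_scheme \<Rightarrow> ('g \<Rightarrow> 'a::cstar_algebra \<Rightarrow> 'a) \<Rightarrow> bool"
  where "Rokhlin_property G \<alpha> \<longleftrightarrow>
    (\<forall>F \<epsilon>. finite F \<and> \<epsilon> > 0 \<longrightarrow>
      (\<exists>r :: 'g \<Rightarrow> 'a.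
        (\<forall>g\<in>carrier G. positive (r g) \<and> norm (r g) \<le> 1) \<and>
        (\<forall>g\<in>carrier G. \<forall>h\<in>carrier G. g \<noteq> h \<longrightarrow> r g * r h = 0) \<and>
        (\<forall>g\<in>carrier G. \<forall>h\<in>carrier G. norm (\<alpha> g (r h) - r (g \<otimes>\<^bsub>G\<^esub> h)) < \<epsilon>) \<and>
        (\<forall>a\<in>F. \<forall>g\<in>carrier G. norm (r g * a - a * r g) < \<epsilon>) \<and>
        (\<forall>a\<in>F. norm ((\<Sum>g\<in>carrier G. r g) * a - a) < \<epsilon>)))"

end

theory Submission
  imports Defs
begin

text \<open>
  Write \<open>Ad w\<close> for conjugation by a unitary \<open>w\<close> of the algebra with adjoined unit. The automorphism
  is found as a pointwise limit \<open>\<psi> = lim Ad w\<^sub>n\<close>, where the unitaries \<open>w\<^sub>n\<close> are built by an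
  Evans--Kishimoto intertwining: the conjugated action \<open>Ad w\<^sub>n \<circ> \<alpha>\<^sub>g \<circ> (Ad w\<^sub>n)\<^sup>-\<^sup>1\<close> becomes closer and closer
  to \<open>\<beta>\<^sub>g\<close>, while the corrections \<open>w\<^sub>n\<^sub>+\<^sub>1 w\<^sub>n\<^sup>*\<close> almost commute with more and more elements. The first
  property gives \<open>\<psi> \<circ> \<alpha>\<^sub>g = \<beta>\<^sub>g \<circ> \<psi>\<close>, the second gives convergence of \<open>Ad w\<^sub>n\<close> and of the inverses.

  A correction is produced as follows (\<open>Rokhlin_intertwining_unitary\<close>). Take unitaries \<open>u\<^sub>h\<close> with
  \<open>Ad u\<^sub>h \<circ> \<alpha>\<^sub>h \<approx> \<beta>\<^sub>h\<close>. A sequence of Rokhlin elements \<open>r\<^sub>h\<close> turns a family \<open>b\<close> indexed by the group into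
  the sequence \<open>\<Sum>\<^sub>h r\<^sub>h b\<^sub>h\<close>, and asymptotically this is a star-homomorphism on the algebra of such
  families, which fixes constant families and is equivariant (\<open>blend_mult\<close>, \<open>blend_star\<close>,
  \<open>blend_const\<close>, \<open>blend_action\<close>). Hence it maps the unitary family \<open>u\<close> to almost unitaries, near
  which there are unitaries \<open>w\<close> (\<open>blended_unitaries\<close>), and \<open>Ad w x \<approx> \<Sum>\<^sub>h r\<^sub>h Ad u\<^sub>h x\<close>. Since
  \<open>Ad u\<^sub>h \<approx> \<beta>\<^sub>h \<circ> \<alpha>\<^sub>h\<^sup>-\<^sup>1\<close>, translating the index by \<open>g\<close> gives \<open>Ad w \<circ> \<alpha>\<^sub>g \<approx> \<beta>\<^sub>g \<circ> Ad w\<close>; and where \<open>\<alpha>\<close> and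
  \<open>\<beta>\<close> already nearly agree, \<open>Ad u\<^sub>h x \<approx> x\<close>, so that \<open>w\<close> almost commutes with \<open>x\<close>.

  Everything stays elementary. Orthogonality and \<open>\<Sum>\<^sub>h r\<^sub>h b \<approx> b\<close> give \<open>r\<^sub>h\<^sup>2 b \<approx> r\<^sub>h b\<close>, so that the
  Rokhlin elements act like projections; unitaries near almost unitaries, and the contractivity of
  star-homomorphisms, come from square roots found as fixed points of contractions.
\<close>


section \<open>Star-homomorphisms are contractive\<close>

lemma bounded_linear_star: "bounded_linear (star :: 'a::cstar_algebra \<Rightarrow> 'a)"
proof (rule bounded_linear_intro[where K = 1])
  fix r and x :: 'a
  show "star (r *\<^sub>R x) = r *\<^sub>R star x" by (simp add: scaleR_scaleC star_scaleC)
qed (simp_all add: star_add norm_star)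

lemmas star_diff = linear_diff[OF bounded_linear.linear, OF bounded_linear_star]
lemmas star_scaleR = linear_scale[OF bounded_linear.linear, OF bounded_linear_star]
lemmas scaleC_diff_right = linear_diff[OF bounded_linear.linear, OF bounded_linear_scaleC_right]
lemmas star_sum = linear_sum[OF bounded_linear.linear, OF bounded_linear_star]
lemmas tendsto_star = bounded_linear.tendsto[OF bounded_linear_star]

lemma star_one: "star (1 :: 'a::cstar_algebra_1) = 1"
  by (metis mult.left_neutral mult.right_neutral star_mult star_star)

text \<open>
  If \<open>y = 1 - z\<close>, the equation \<open>h\<^sup>2 + y\<^sup>2 = 1\<close> says that \<open>z\<close> is a fixed point of
  \<open>z \<mapsto> (h\<^sup>2 + z\<^sup>2) / 2\<close>. On the self-adjoint elements of norm at most \<open>norm h\<close> that commute with \<open>h\<close>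
  this map is a contraction.
\<close>

lemma selfadjoint_sqrt:
  fixes h :: "'a::cstar_algebra_1"
  assumes h: "star h = h" "norm h < 1"
  obtains y where "star y = y" "h * y = y * h" "h * h + y * y = 1"
proof -
  define \<rho> where "\<rho> = norm h"
  have \<rho>: "0 \<le> \<rho>" "\<rho> < 1" using h by (simp_all add: \<rho>_def)
  have hh: "norm (h * h) \<le> \<rho>"
    using norm_mult_ineq[of h h] mult_left_le[of \<rho> \<rho>] \<rho> by (simp add: \<rho>_def)
  define S where "S = {z. norm z \<le> \<rho> \<and> star z = z \<and> h * z = z * h}"
  define f where "f z = (1/2) *\<^sub>R (h * h + z * z)" for z
  have "closed S"
    unfolding S_def
    by (intro closed_Collect_conj closed_Collect_le closed_Collect_eq continuous_intros
        linear_continuous_on bounded_linear_star)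
  then have "complete S" by (simp add: complete_eq_closed)
  moreover have "0 \<in> S" using \<rho> by (simp add: S_def star_zero)
  moreover have "f ` S \<subseteq> S"
  proof (clarify)
    fix z assume z: "z \<in> S"
    then have nz: "norm z \<le> \<rho>" by (simp add: S_def)
    have "norm (z * z) \<le> \<rho> * \<rho>"
      by (rule order_trans[OF norm_mult_ineq]) (intro mult_mono nz norm_ge_zero \<rho>)
    also have "\<dots> \<le> \<rho>" using \<rho> by (simp add: mult_left_le)
    finally have "norm (h * h + z * z) \<le> 2 * \<rho>"
      using hh norm_triangle_ineq[of "h * h" "z * z"] by linarith
    moreover have "h * (z * z) = z * z * h"
      using z by (simp add: S_def) (metis mult.assoc)
    moreover from calculation(1) have "norm (f z) \<le> \<rho>" by (simp add: f_def)
    ultimately show "f z \<in> S"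
      using z h unfolding S_def mem_Collect_eq
      by (intro conjI) (simp_all add: f_def star_scaleR star_add star_mult algebra_simps)
  qed
  moreover have "dist (f x) (f y) \<le> \<rho> * dist x y" if "x \<in> S" "y \<in> S" for x y
  proof -
    have "2 *\<^sub>R (f x - f y) = x * (x - y) + (x - y) * y"
      by (simp add: f_def algebra_simps)
    then have "2 * norm (f x - f y) = norm (x * (x - y) + (x - y) * y)"
      by (metis abs_numeral norm_scaleR)
    also have "\<dots> \<le> norm x * norm (x - y) + norm (x - y) * norm y"
      by (intro order_trans[OF norm_triangle_ineq] add_mono norm_mult_ineq)
    also have "\<dots> \<le> \<rho> * norm (x - y) + norm (x - y) * \<rho>"
      using that by (intro add_mono mult_mono) (auto simp: S_def \<rho>)
    finally show ?thesis by (simp add: dist_norm)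
  qed
  ultimately have "\<exists>!z. z \<in> S \<and> f z = z"
    using \<rho> by (intro Banach_fix[where c = \<rho>]) auto
  then obtain z where z: "z \<in> S" "f z = z" by blast
  have fz: "z + z = h * h + z * z"
    using arg_cong[OF z(2), of "\<lambda>t. t + t"] unfolding f_def
    by (simp flip: scaleR_add_left)
  show thesis
  proof (rule that[of "1 - z"])
    have "h * h + (1 - z) * (1 - z) = 1 + (h * h + z * z) - (z + z)"
      by (simp add: algebra_simps)
    then show "h * h + (1 - z) * (1 - z) = 1" using fz by simp
  qed (use z in \<open>auto simp: S_def star_diff star_one algebra_simps\<close>)
qed

lemma star_hom_scaleR: "star_hom \<phi> \<Longrightarrow> \<phi> (r *\<^sub>R x) = r *\<^sub>R \<phi> x"
  by (simp add: star_hom_def scaleR_scaleC)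

lemma star_hom_add: "star_hom \<phi> \<Longrightarrow> \<phi> (x + y) = \<phi> x + \<phi> y"
  and star_hom_scaleC: "star_hom \<phi> \<Longrightarrow> \<phi> (c *\<^sub>C x) = c *\<^sub>C \<phi> x"
  and star_hom_mult: "star_hom \<phi> \<Longrightarrow> \<phi> (x * y) = \<phi> x * \<phi> y"
  and star_hom_star: "star_hom \<phi> \<Longrightarrow> \<phi> (star x) = star (\<phi> x)"
  by (simp_all add: star_hom_def)

text \<open>
  A self-adjoint \<open>h\<close> of norm less than \<open>1\<close> is the real part of a unitary \<open>h + \<i> y\<close>. Its image is then
  the real part of a unitary too and has norm at most \<open>1\<close>. Scaling gives all self-adjoint elements,
  and the C*-identity the rest.
\<close>

lemma unital_star_hom_contractive:
  fixes \<phi> :: "'a::cstar_algebra_1 \<Rightarrow> 'b::cstar_algebra_1"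
  assumes \<phi>: "star_hom \<phi>" and one: "\<phi> 1 = 1"
  shows "norm (\<phi> x) \<le> norm x"
proof -
  have unit_ball: "norm (\<phi> h) \<le> 1" if h: "star h = h" "norm h < 1" for h
  proof -
    obtain y where y: "star y = y" "h * y = y * h" "h * h + y * y = 1"
      using selfadjoint_sqrt[OF h] .
    define k l w where "k = \<phi> h" and "l = \<phi> y" and "w = k + \<i> *\<^sub>C l"
    have kl: "star k = k" "star l = l" "k * l = l * k" "k * k + l * l = 1"
      using y h one star_hom_star[OF \<phi>] star_hom_mult[OF \<phi>] star_hom_add[OF \<phi>]
      unfolding k_def l_def by metis+
    have sw: "star w = k - \<i> *\<^sub>C l"
      by (simp add: w_def star_add star_scaleC kl scaleC_minus_left)
    have "star w * w = k * k - (\<i> * \<i>) *\<^sub>C (l * l)"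
      unfolding sw by (simp add: w_def algebra_simps mult_scaleC_left mult_scaleC_right
          scaleC_scaleC kl scaleC_add_right scaleC_diff_right)
    then have "star w * w = 1"
      using kl by (simp add: scaleC_minus_left scaleC_one)
    then have "norm w = 1"
      using cstar_identity[of w] by (simp add: power2_eq_1_iff) (smt (verit) norm_ge_zero)
    moreover have "2 *\<^sub>R k = w + star w" unfolding sw by (simp add: w_def scaleR_2)
    then have "2 * norm k = norm (w + star w)" by (metis abs_numeral norm_scaleR)
    ultimately show ?thesis
      using norm_triangle_ineq[of w "star w"] by (simp add: norm_star k_def)
  qed
  \<comment> \<open>Scaling by a number strictly between the two norms would move \<open>h\<close> inside and \<open>\<phi> h\<close> outside the unit ball.\<close>
  have sa: "norm (\<phi> h) \<le> norm h" if h: "star h = h" for h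
  proof (rule ccontr)
    assume "\<not> ?thesis"
    then obtain r where r: "norm h < r" "r < norm (\<phi> h)" by (meson dense not_le)
    have r0: "0 < r" using r(1) norm_ge_zero[of h] by linarith
    have "norm (\<phi> ((1/r) *\<^sub>R h)) \<le> 1"
      using r r0 h by (intro unit_ball) (auto simp: star_scaleR)
    then show False using r r0 by (simp add: star_hom_scaleR[OF \<phi>])
  qed
  have "(norm (\<phi> x))\<^sup>2 = norm (\<phi> (star x * x))"
    by (simp add: star_hom_mult[OF \<phi>] star_hom_star[OF \<phi>] cstar_identity)
  also have "\<dots> \<le> (norm x)\<^sup>2"
    using sa[of "star x * x"] by (simp add: star_mult star_star cstar_identity)
  finally show ?thesis by (simp add: power2_le_iff_abs_le)
qed

definition unitization_map :: "('a \<Rightarrow> 'b) \<Rightarrow> 'a unitization \<Rightarrow> 'b unitization"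
  where "unitization_map \<phi> x = Unitization (\<phi> (uni_alg x)) (uni_scal x)"

lemma star_hom_zero: "star_hom \<phi> \<Longrightarrow> \<phi> 0 = 0"
  by (metis add_cancel_right_right star_hom_add)

lemma star_hom_unitization_map:
  assumes \<phi>: "star_hom \<phi>"
  shows "star_hom (unitization_map \<phi>)" "unitization_map \<phi> 1 = 1"
  using star_hom_zero[OF \<phi>] \<phi>
  by (simp_all add: star_hom_def unitization_map_def unitization_star_defs)

lemma star_hom_contractive:
  assumes \<phi>: "star_hom \<phi>"
  shows "norm (\<phi> x) \<le> norm x"
proof -
  have "norm (unitization_map \<phi> (uni_embed x)) \<le> norm (uni_embed x)"
    by (intro unital_star_hom_contractive star_hom_unitization_map \<phi>)
  then show ?thesis by (simp add: unitization_map_def norm_uni_embed)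
qed

lemma star_hom_bounded_linear: "star_hom \<phi> \<Longrightarrow> bounded_linear \<phi>"
  by (rule bounded_linear_intro[where K = 1])
    (simp_all add: star_hom_add star_hom_scaleR star_hom_contractive)

lemmas star_hom_diff = linear_diff[OF bounded_linear.linear, OF star_hom_bounded_linear]
lemmas star_hom_sum = linear_sum[OF bounded_linear.linear, OF star_hom_bounded_linear]
lemmas star_hom_tendsto = bounded_linear.tendsto[OF star_hom_bounded_linear]


section \<open>Perturbing almost unitary elements\<close>

text \<open>
  The element \<open>1 + z\<close> is the inverse square root of \<open>1 - e\<close>. Among elements commuting with \<open>e\<close>,
  expanding \<open>(1 + z)\<^sup>2 (1 - e) = 1\<close> gives \<open>2 z = e + 2 z e - z\<^sup>2 + z\<^sup>2 e\<close>, again a fixed-point equation.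
  The bound \<open>1/4\<close> makes its right-hand side, halved, a contraction of the ball of radius \<open>norm e\<close>.
\<close>

lemma selfadjoint_inverse_sqrt:
  fixes e :: "'a::cstar_algebra_1"
  assumes e: "star e = e" "norm e \<le> 1/4"
  obtains z where "star z = z" "norm z \<le> norm e" "(1 + z) * (1 - e) * (1 + z) = 1"
proof -
  define d where "d = norm e"
  have d: "0 \<le> d" "d \<le> 1/4" using e by (simp_all add: d_def)
  define S where "S = {z. norm z \<le> d \<and> star z = z \<and> e * z = z * e}"
  define f where "f z = (1/2) *\<^sub>R (e + 2 *\<^sub>R (z * e) - z * z + z * z * e)" for z
  have "closed S"
    unfolding S_def
    by (intro closed_Collect_conj closed_Collect_le closed_Collect_eq continuous_intros
        linear_continuous_on bounded_linear_star)
  then have "complete S" by (simp add: complete_eq_closed)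
  moreover have "0 \<in> S" using d by (simp add: S_def star_zero)
  moreover have "f ` S \<subseteq> S"
  proof (clarify)
    fix z assume z: "z \<in> S"
    then have nz: "norm z \<le> d" and com: "e * z = z * e" by (simp_all add: S_def)
    have ze: "norm (z * e) \<le> d * d"
      by (rule order_trans[OF norm_mult_ineq]) (intro mult_mono nz, auto simp: d_def)
    have zz: "norm (z * z) \<le> d * d"
      by (rule order_trans[OF norm_mult_ineq]) (intro mult_mono nz, auto simp: d)
    have zze: "norm (z * z * e) \<le> d * d * d"
      by (rule order_trans[OF norm_mult_ineq]) (intro mult_mono zz, auto simp: d_def)
    have "norm (e + 2 *\<^sub>R (z * e) - z * z + z * z * e)
        \<le> d + 2 * norm (z * e) + norm (z * z) + norm (z * z * e)"
      unfolding d_def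
      by (intro norm_triangle_le norm_triangle_le_diff add_mono order_refl) simp
    also have "\<dots> \<le> d + 3 * (d * d) + d * d * d" using ze zz zze by linarith
    also have "\<dots> \<le> 2 * d"
    proof -
      have "d * d \<le> 1/4 * d" by (intro mult_right_mono d)
      moreover have "d * d * d \<le> 1/16 * d"
        using mult_mono[of d "1/4" d "1/4"] d by (intro mult_right_mono) auto
      ultimately show ?thesis using d by linarith
    qed
    finally have "norm (f z) \<le> d" by (simp add: f_def)
    moreover have 1: "e * (z * z) = z * z * e" by (metis com mult.assoc)
    then have "e * f z = f z * e"
      by (simp add: f_def algebra_simps com) (simp add: com flip: mult.assoc)
    moreover have "star (f z) = f z"
      using z e 1 by (simp add: S_def f_def star_scaleR star_add star_diff star_mult)
    ultimately show "f z \<in> S" by (simp add: S_def)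
  qed
  moreover have "dist (f x) (f y) \<le> (3/4) * dist x y" if xy: "x \<in> S" "y \<in> S" for x y
  proof -
    have nx: "norm x \<le> d" and ny: "norm y \<le> d" using xy by (simp_all add: S_def)
    define m where "m = norm (x - y)"
    define s where "s = x * x - y * y"
    have sq: "norm s \<le> 2 * d * m"
    proof -
      have "norm s = norm (x * (x - y) + (x - y) * y)" by (simp add: s_def algebra_simps)
      also have "\<dots> \<le> norm x * m + m * norm y"
        unfolding m_def by (intro order_trans[OF norm_triangle_ineq] add_mono norm_mult_ineq)
      also have "\<dots> \<le> d * m + m * d"
        using nx ny by (intro add_mono mult_mono) (auto simp: d m_def)
      finally show ?thesis by simp
    qed
    have "2 *\<^sub>R (f x - f y) = 2 *\<^sub>R ((x - y) * e) - s + s * e"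
      by (simp add: f_def s_def algebra_simps)
    then have "2 * norm (f x - f y)
        = norm (2 *\<^sub>R ((x - y) * e) - s + s * e)"
      by (metis abs_numeral norm_scaleR)
    also have "\<dots> \<le> 2 * (m * d) + 2 * d * m + 2 * d * m * d"
    proof (intro norm_triangle_le norm_triangle_le_diff add_mono sq)
      show "norm (2 *\<^sub>R ((x - y) * e)) \<le> 2 * (m * d)"
        using norm_mult_ineq[of "x - y" e] by (simp add: m_def d_def)
      show "norm (s * e) \<le> 2 * d * m * d"
        by (rule order_trans[OF norm_mult_ineq]) (intro mult_mono sq, auto simp: d_def m_def)
    qed
    also have "\<dots> \<le> 2 * (m * (1/4)) + 2 * (1/4) * m + 2 * (1/4) * m * (1/4)"
      using d by (intro add_mono mult_mono) (auto simp: m_def)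
    also have "\<dots> \<le> 2 * ((3/4) * m)" by (simp add: m_def)
    finally show ?thesis by (simp add: dist_norm m_def)
  qed
  ultimately have "\<exists>!z. z \<in> S \<and> f z = z"
    by (intro Banach_fix[where c = "3/4"]) auto
  then obtain z where z: "z \<in> S" "f z = z" by blast
  have fz: "z + z = e + 2 *\<^sub>R (z * e) - z * z + z * z * e"
    using arg_cong[OF z(2), of "\<lambda>t. t + t"] unfolding f_def
    by (simp flip: scaleR_add_left)
  have com: "e * z = z * e" using z by (simp add: S_def)
  show thesis
  proof (rule that[of z])
    have "(1 + z) * (1 - e) * (1 + z)
        = 1 + (z + z) - (e + 2 *\<^sub>R (z * e) - z * z + z * z * e)"
      using com by (simp add: algebra_simps scaleR_2)
    then show "(1 + z) * (1 - e) * (1 + z) = 1" using fz by simp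
  qed (use z in \<open>auto simp: S_def d_def\<close>)
qed

text \<open>
  The unitary part \<open>w = v (v\<^sup>* v)\<^sup>-\<^sup>1\<^sup>/\<^sup>2\<close> of the polar decomposition is an isometry that differs little
  from \<open>v\<close>. It is also a co-isometry: \<open>q = 1 - w w\<^sup>*\<close> is a projection, so its norm is \<open>0\<close> or \<open>1\<close>, and
  it is close to \<open>1 - v v\<^sup>*\<close>, which is small.
\<close>

lemma unitary_near_almost_unitary:
  fixes v :: "'a::cstar_algebra_1"
  assumes 1: "norm (star v * v - 1) \<le> 1/8" and 2: "norm (v * star v - 1) \<le> 1/8"
  obtains w where "unitary w" "norm (w - v) \<le> 2 * norm (star v * v - 1)"
proof -
  define e where "e = 1 - star v * v"
  have e: "star e = e" "norm e \<le> 1/8" "norm e = norm (star v * v - 1)"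
    using 1 by (simp_all add: e_def star_diff star_one star_mult star_star norm_minus_commute)
  obtain z where z: "star z = z" "norm z \<le> norm e" "(1 + z) * (1 - e) * (1 + z) = 1"
    using selfadjoint_inverse_sqrt[of e] e by auto
  define w where "w = v * (1 + z)"
  have sw: "star w = (1 + z) * star v"
    by (simp add: w_def star_mult star_add star_one z)
  have ww: "star w * w = 1"
    using z(3) by (simp add: sw) (simp add: w_def e_def mult.assoc)
  have nv2: "norm v * norm v \<le> 9/8"
    using norm_triangle_ineq[of "star v * v - 1" 1] 1 cstar_identity[of v]
    by (simp add: power2_eq_square)
  have nv: "norm v \<le> 2"
  proof (rule ccontr)
    assume "\<not> ?thesis"
    then have "2 * 2 \<le> norm v * norm v" by (intro mult_mono) auto
    then show False using nv2 by simp
  qed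
  define q where "q = 1 - w * star w"
  have "w * star w * (w * star w) = w * star w"
    by (metis mult.assoc mult.right_neutral ww)
  then have "star q * q = q"
    by (simp add: q_def star_diff star_one star_mult star_star algebra_simps)
  then have qq: "norm q * norm q = norm q"
    using cstar_identity[of q] by (simp add: power2_eq_square)
  have "q = (1 - v * star v) - v * (z + z + z * z) * star v"
    unfolding q_def sw by (simp add: w_def algebra_simps)
  then have "norm q \<le> norm (1 - v * star v) + norm (v * (z + z + z * z) * star v)"
    by (simp add: norm_triangle_ineq4)
  also have "norm (v * (z + z + z * z) * star v) \<le> norm v * (1/8 + 1/8 + 1/8 * (1/8)) * norm v"
  proof (rule order_trans[OF norm_mult_ineq], rule mult_mono)
    have "norm (z + z + z * z) \<le> 1/8 + 1/8 + 1/8 * (1/8)"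
      using z e by (intro norm_triangle_le add_mono order_trans[OF norm_mult_ineq] mult_mono) auto
    then show "norm (v * (z + z + z * z)) \<le> norm v * (1/8 + 1/8 + 1/8 * (1/8))"
      by (intro order_trans[OF norm_mult_ineq] mult_left_mono) auto
  qed (auto simp: norm_star)
  also have "\<dots> = (norm v * norm v) * (17/64)" by simp
  finally have "norm q < 1"
    using 2 nv2 by (simp add: norm_minus_commute)
  then have "q = 0" using qq by (metis less_irrefl mult_cancel_right2 norm_eq_zero)
  then have "unitary w" by (simp add: unitary_def ww q_def)
  moreover have "norm (w - v) \<le> norm v * norm z"
    using norm_mult_ineq[of v z] by (simp add: w_def algebra_simps)
  then have "norm (w - v) \<le> 2 * norm (star v * v - 1)"
    using mult_mono[OF nv z(2)] e by simp
  ultimately show thesis using that by blast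
qed

section \<open>Sequences that agree asymptotically\<close>

definition asymp_eq :: "(nat \<Rightarrow> 'a::real_normed_vector) \<Rightarrow> (nat \<Rightarrow> 'a) \<Rightarrow> bool"  (infix "\<simeq>" 50)
  where "X \<simeq> Y \<longleftrightarrow> (\<lambda>n. X n - Y n) \<longlonglongrightarrow> 0"

lemma asymp_refl [simp]: "X \<simeq> X"
  by (simp add: asymp_eq_def)

lemma asymp_sym: "X \<simeq> Y \<Longrightarrow> Y \<simeq> X"
  unfolding asymp_eq_def by (drule tendsto_minus) simp

lemma asymp_trans [trans]: "X \<simeq> Y \<Longrightarrow> Y \<simeq> Z \<Longrightarrow> X \<simeq> Z"
  unfolding asymp_eq_def by (drule (1) tendsto_add) simp

lemma asymp_add: "X \<simeq> Y \<Longrightarrow> X' \<simeq> Y' \<Longrightarrow> (\<lambda>n. X n + X' n) \<simeq> (\<lambda>n. Y n + Y' n)"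
  unfolding asymp_eq_def by (drule (1) tendsto_add) (simp add: algebra_simps)

lemma asymp_diff: "X \<simeq> Y \<Longrightarrow> X' \<simeq> Y' \<Longrightarrow> (\<lambda>n. X n - X' n) \<simeq> (\<lambda>n. Y n - Y' n)"
  unfolding asymp_eq_def by (drule (1) tendsto_diff) (simp add: algebra_simps)

lemma asymp_sum: "(\<And>i. i \<in> I \<Longrightarrow> X i \<simeq> Y i) \<Longrightarrow> (\<lambda>n. \<Sum>i\<in>I. X i n) \<simeq> (\<lambda>n. \<Sum>i\<in>I. Y i n)"
  unfolding asymp_eq_def sum_subtractf [symmetric] by (rule tendsto_null_sum)

lemma asymp_bounded_linear:
  "bounded_linear f \<Longrightarrow> X \<simeq> Y \<Longrightarrow> (\<lambda>n. f (X n)) \<simeq> (\<lambda>n. f (Y n))"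
  unfolding asymp_eq_def
  by (simp flip: linear_diff[OF bounded_linear.linear]) (rule bounded_linear.tendsto_zero)

lemma asymp_mult_left:
  fixes Z :: "nat \<Rightarrow> 'a::real_normed_algebra"
  shows "Bseq Z \<Longrightarrow> X \<simeq> Y \<Longrightarrow> (\<lambda>n. Z n * X n) \<simeq> (\<lambda>n. Z n * Y n)"
  unfolding asymp_eq_def tendsto_Zfun_iff
  by (drule (1) bounded_bilinear.Bfun_prod_Zfun[OF bounded_bilinear_mult])
    (simp add: algebra_simps)

lemma asymp_mult_right:
  fixes Z :: "nat \<Rightarrow> 'a::real_normed_algebra"
  shows "Bseq Z \<Longrightarrow> X \<simeq> Y \<Longrightarrow> (\<lambda>n. X n * Z n) \<simeq> (\<lambda>n. Y n * Z n)"
  unfolding asymp_eq_def tendsto_Zfun_iff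
  by (drule (1) bounded_bilinear.Zfun_prod_Bfun[OF bounded_bilinear_mult, rotated])
    (simp add: algebra_simps)

lemma asymp_mult:
  fixes X :: "nat \<Rightarrow> 'a::real_normed_algebra"
  assumes "Bseq X" "Bseq Y'" "X \<simeq> Y" "X' \<simeq> Y'"
  shows "(\<lambda>n. X n * X' n) \<simeq> (\<lambda>n. Y n * Y' n)"
  using asymp_mult_left[OF assms(1,4)] asymp_mult_right[OF assms(2,3)] by (rule asymp_trans)

lemma asymp_eventually_norm_le:
  assumes "X \<simeq> Y" "\<And>n. norm (Y n) \<le> K" "\<epsilon> > 0"
  shows "\<forall>\<^sub>F n in sequentially. norm (X n) \<le> K + \<epsilon>"
proof -
  have "\<forall>\<^sub>F n in sequentially. norm (X n - Y n) < \<epsilon>"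
    using order_tendstoD(2)[OF tendsto_norm_zero] assms(1,3) unfolding asymp_eq_def by blast
  then show ?thesis
  proof eventually_elim
    case (elim n)
    then show ?case
      using norm_triangle_ineq[of "Y n" "X n - Y n"] assms(2)[of n] by simp
  qed
qed

text \<open>
  For a uniformly bounded sequence of linear maps, the elements on which it tends to zero form a
  closed set.
\<close>

lemma dense_tendsto_zero:
  assumes lin: "\<And>n. linear (L n)" and bound: "\<And>n x. norm (L n x) \<le> K * norm x"
    and dense: "closure D = UNIV" and zero: "\<And>x. x \<in> D \<Longrightarrow> (\<lambda>n. L n x) \<longlonglongrightarrow> 0"
  shows "(\<lambda>n. L n x) \<longlonglongrightarrow> 0"
proof (rule LIMSEQ_I)
  fix \<epsilon> :: real assume \<epsilon>: "0 < \<epsilon>"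
  define \<eta> where "\<eta> = \<epsilon> / (2 * (\<bar>K\<bar> + 1))"
  have \<eta>: "0 < \<eta>" "(\<bar>K\<bar> + 1) * \<eta> = \<epsilon> / 2"
    using \<epsilon> by (simp_all add: \<eta>_def field_simps add_pos_nonneg)
  obtain y where y: "y \<in> D" "norm (x - y) < \<eta>"
    using dense \<eta>(1) by (metis UNIV_I closure_approachable dist_commute dist_norm)
  obtain N where N: "norm (L n y) < \<epsilon> / 2" if "n \<ge> N" for n
    using LIMSEQ_D[OF zero[OF y(1)], of "\<epsilon> / 2"] \<epsilon> by auto
  have "norm (L n x) < \<epsilon>" if "n \<ge> N" for n
  proof -
    have "norm (L n (x - y)) \<le> K * norm (x - y)" by (rule bound)
    also have "\<dots> \<le> (\<bar>K\<bar> + 1) * \<eta>" using y(2) by (intro mult_mono) auto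
    finally have "norm (L n (x - y)) \<le> \<epsilon> / 2" using \<eta> by simp
    moreover have "L n x = L n y + L n (x - y)" by (simp add: linear_diff[OF lin])
    ultimately show ?thesis
      using norm_triangle_ineq[of "L n y" "L n (x - y)"] N[OF that] by simp
  qed
  then show "\<exists>N. \<forall>n\<ge>N. norm (L n x - 0) < \<epsilon>" by auto
qed

text \<open>
  The bound of \<open>unitary_near_almost_unitary\<close> is available only for large \<open>n\<close>; the finitely many
  other terms do not affect the limit and are set to \<open>1\<close>.
\<close>

lemma asymp_unitaries:
  fixes v :: "nat \<Rightarrow> 'a::cstar_algebra_1"
  assumes "(\<lambda>n. star (v n) * v n) \<simeq> (\<lambda>n. 1)" and "(\<lambda>n. v n * star (v n)) \<simeq> (\<lambda>n. 1)"
  obtains w where "\<And>n. unitary (w n)" "w \<simeq> v"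
proof -
  define small where "small n \<longleftrightarrow>
    norm (star (v n) * v n - 1) \<le> 1/8 \<and> norm (v n * star (v n) - 1) \<le> 1/8" for n
  have "\<exists>w. unitary w \<and> (small n \<longrightarrow> norm (w - v n) \<le> 2 * norm (star (v n) * v n - 1))" for n
  proof (cases "small n")
    case True
    then show ?thesis
      using unitary_near_almost_unitary[of "v n"] unfolding small_def by blast
  next
    case False
    then show ?thesis by (intro exI[of _ 1]) (simp add: unitary_def star_one)
  qed
  then obtain w where w: "\<And>n. unitary (w n)"
      "\<And>n. small n \<Longrightarrow> norm (w n - v n) \<le> 2 * norm (star (v n) * v n - 1)"
    by metis
  have 1: "(\<lambda>n. norm (star (v n) * v n - 1)) \<longlonglongrightarrow> 0" and 2: "(\<lambda>n. norm (v n * star (v n) - 1)) \<longlonglongrightarrow> 0"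
    using assms by (auto simp: asymp_eq_def intro: tendsto_norm_zero)
  have "\<forall>\<^sub>F n in sequentially. small n"
    using order_tendstoD(2)[OF 1, of "1/8"] order_tendstoD(2)[OF 2, of "1/8"]
    unfolding small_def by (intro eventually_conj) (auto elim: eventually_mono)
  then have "\<forall>\<^sub>F n in sequentially. norm (w n - v n) \<le> 2 * norm (star (v n) * v n - 1)"
    by eventually_elim (rule w(2))
  then have "w \<simeq> v"
    unfolding asymp_eq_def by (rule Lim_null_comparison) (use tendsto_mult_right_zero[OF 1] in simp)
  with w(1) that show thesis by blast
qed


section \<open>Inner automorphisms\<close>

text \<open>
  The original algebra is an ideal of the unitization, so \<open>uni_alg\<close> loses nothing here: compare
  \<open>uni_embed_ad\<close>.
\<close>

definition ad :: "'a::cstar_algebra unitization \<Rightarrow> 'a \<Rightarrow> 'a"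
  where "ad u x = uni_alg (u * uni_embed x * star u)"

lemma uni_embed_add: "uni_embed (x + y :: 'a::cstar_algebra) = uni_embed x + uni_embed y"
  and uni_embed_diff: "uni_embed (x - y :: 'a::cstar_algebra) = uni_embed x - uni_embed y"
  and uni_embed_mult: "uni_embed (x * y :: 'a::cstar_algebra) = uni_embed x * uni_embed y"
  and uni_embed_scaleC: "uni_embed (c *\<^sub>C x :: 'a::cstar_algebra) = c *\<^sub>C uni_embed x"
  and uni_embed_star: "uni_embed (star x :: 'a::cstar_algebra) = star (uni_embed x)"
  by (simp_all add: unitization_star_defs scaleC_zero_left)

lemma uni_embed_ad: "uni_embed (ad u x) = u * uni_embed x * star u"
  by (simp add: ad_def unitization_star_defs unitization.expand)

lemma uni_embed_eqI: "uni_embed x = uni_embed y \<Longrightarrow> x = y"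
  by simp

lemma unitary_star: "unitary u \<Longrightarrow> unitary (star u)"
  by (simp add: unitary_def star_star)

lemma unitary_mult: "unitary u \<Longrightarrow> unitary v \<Longrightarrow> unitary (u * v)"
  using mult.assoc[of "star v * star u" u v] mult.assoc[of "star v" "star u" u]
    mult.assoc[of "u * v" "star v" "star u"] mult.assoc[of u v "star v"]
  by (simp add: unitary_def star_mult)

lemma unitary_one: "unitary 1"
  by (simp add: unitary_def star_one)

lemma norm_unitary: "unitary u \<Longrightarrow> norm u = 1"
  using cstar_identity[of u] by (simp add: unitary_def power2_eq_1_iff) (smt (verit) norm_ge_zero)

lemma ad_mult: "ad (u * v) x = ad u (ad v x)"
  by (rule uni_embed_eqI) (simp add: uni_embed_ad star_mult mult.assoc)

lemma ad_one: "ad 1 x = x"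
  by (rule uni_embed_eqI) (simp add: uni_embed_ad star_one)

lemma ad_star_ad: "unitary u \<Longrightarrow> ad (star u) (ad u x) = x"
  and ad_ad_star: "unitary u \<Longrightarrow> ad u (ad (star u) x) = x"
  by (simp_all add: unitary_def ad_one flip: ad_mult)

lemma star_hom_ad:
  assumes "unitary u"
  shows "star_hom (ad u)"
proof -
  have "u * (uni_embed x * uni_embed y) * star u = u * uni_embed x * star u * (u * uni_embed y * star u)"
    for x y
  proof -
    have "u * uni_embed x * star u * (u * uni_embed y * star u)
        = u * uni_embed x * (star u * u) * uni_embed y * star u" by (simp only: mult.assoc)
    then show ?thesis using assms by (simp add: unitary_def) (simp add: mult.assoc)
  qed
  then have "uni_embed (ad u (x * y)) = uni_embed (ad u x * ad u y)" for x y
    by (simp only: uni_embed_ad uni_embed_mult)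
  moreover have "uni_embed (ad u (x + y)) = uni_embed (ad u x + ad u y)" for x y
    by (simp only: uni_embed_ad uni_embed_add distrib_left distrib_right)
  moreover have "uni_embed (ad u (c *\<^sub>C x)) = uni_embed (c *\<^sub>C ad u x)" for c x
    by (simp only: uni_embed_ad uni_embed_scaleC mult_scaleC_left mult_scaleC_right)
  moreover have "uni_embed (ad u (star x)) = uni_embed (star (ad u x))" for x
    by (simp only: uni_embed_ad uni_embed_star star_mult star_star mult.assoc)
  ultimately show ?thesis by (simp add: star_hom_def)
qed

lemma norm_ad: "unitary u \<Longrightarrow> norm (ad u x) = norm x"
  using star_hom_contractive[OF star_hom_ad, of u x]
    star_hom_contractive[OF star_hom_ad, of "star u" "ad u x"]
  by (simp add: ad_star_ad unitary_star)

text \<open>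
  Moving a unitary to the other side of an approximate equality: this is what makes approximate
  unitary equivalence symmetric and lets the two actions change roles below.
\<close>

lemma norm_diff_ad_star: "unitary u \<Longrightarrow> norm (y - ad (star u) x) = norm (ad u y - x)"
  using norm_ad[of u "y - ad (star u) x"] by (simp add: star_hom_diff[OF star_hom_ad] ad_ad_star)

lemma approx_unitarily_equiv_iff_ad:
  "\<phi> \<sim>\<^sub>a\<^sub>u \<psi> \<longleftrightarrow> (\<forall>F \<epsilon>. finite F \<and> \<epsilon> > 0 \<longrightarrow>
    (\<exists>u. unitary u \<and> (\<forall>a\<in>F. norm (ad u (\<phi> a) - \<psi> a) < \<epsilon>)))"
proof -
  have "norm (uni_embed (\<phi> a) - star u * uni_embed (\<psi> a) * u) = norm (ad u (\<phi> a) - \<psi> a)"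
    if u: "unitary u" for u a
  proof -
    have "uni_embed (\<phi> a) - star u * uni_embed (\<psi> a) * u = uni_embed (\<phi> a - ad (star u) (\<psi> a))"
      by (simp add: uni_embed_diff uni_embed_ad star_star)
    then show ?thesis by (simp only: norm_uni_embed norm_diff_ad_star[OF u])
  qed
  then have "(\<exists>u. unitary u \<and> (\<forall>a\<in>F. norm (uni_embed (\<phi> a) - star u * uni_embed (\<psi> a) * u) < \<epsilon>))
      \<longleftrightarrow> (\<exists>u. unitary u \<and> (\<forall>a\<in>F. norm (ad u (\<phi> a) - \<psi> a) < \<epsilon>))" for F \<epsilon>
    by (intro ex_cong1) auto
  then show ?thesis unfolding approx_unitarily_equiv_def by simp
qed

lemma approx_unitarily_equiv_sym:
  assumes "\<phi> \<sim>\<^sub>a\<^sub>u \<psi>"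
  shows "\<psi> \<sim>\<^sub>a\<^sub>u \<phi>"
  unfolding approx_unitarily_equiv_iff_ad
proof (intro allI impI)
  fix F :: "'a set" and \<epsilon> :: real assume "finite F \<and> 0 < \<epsilon>"
  then obtain u where u: "unitary u" "\<forall>a\<in>F. norm (ad u (\<phi> a) - \<psi> a) < \<epsilon>"
    using assms unfolding approx_unitarily_equiv_iff_ad by blast
  then have "\<forall>a\<in>F. norm (ad (star u) (\<psi> a) - \<phi> a) < \<epsilon>"
    by (simp add: norm_minus_commute[of _ "\<phi> _"] norm_diff_ad_star)
  with u show "\<exists>u. unitary u \<and> (\<forall>a\<in>F. norm (ad u (\<psi> a) - \<phi> a) < \<epsilon>)"
    using unitary_star by blast
qed


section \<open>Actions and their conjugates\<close>

text \<open>
  The properties of an element of \<open>hom G Aut\<close> in pointwise form. Bijectivity is implied: \<open>\<alpha> g\<close> has the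
  inverse \<open>\<alpha> (inv g)\<close>.
\<close>

definition is_action :: "('g, 'm) monoid_scheme \<Rightarrow> ('g \<Rightarrow> 'a::cstar_algebra \<Rightarrow> 'a) \<Rightarrow> bool"
  where "is_action G \<alpha> \<longleftrightarrow> (\<forall>g\<in>carrier G. star_hom (\<alpha> g)) \<and> (\<forall>x. \<alpha> \<one>\<^bsub>G\<^esub> x = x) \<and>
    (\<forall>g\<in>carrier G. \<forall>h\<in>carrier G. \<forall>x. \<alpha> (g \<otimes>\<^bsub>G\<^esub> h) x = \<alpha> g (\<alpha> h x))"

lemma is_action_hom_Aut:
  assumes "group G" "\<alpha> \<in> hom G Aut"
  shows "is_action G \<alpha>"
proof -
  have "\<alpha> \<one>\<^bsub>G\<^esub> = \<one>\<^bsub>Aut\<^esub>"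
    using assms group_Aut by (intro group_hom.hom_one group_hom.intro group_hom_axioms.intro)
  moreover have "\<alpha> g \<in> carrier Aut" if "g \<in> carrier G" for g
    using assms(2) that by (auto simp: hom_def)
  ultimately show ?thesis
    using assms(2) by (auto simp: is_action_def Aut_def hom_def)
qed

definition conj_action ::
    "'a::cstar_algebra unitization \<Rightarrow> ('g \<Rightarrow> 'a \<Rightarrow> 'a) \<Rightarrow> 'g \<Rightarrow> 'a \<Rightarrow> 'a"
  where "conj_action w \<alpha> g x = ad w (\<alpha> g (ad (star w) x))"

lemma conj_action_ad: "unitary w \<Longrightarrow> conj_action w \<alpha> g (ad w x) = ad w (\<alpha> g x)"
  by (simp add: conj_action_def ad_star_ad)

lemma conj_action_mult: "conj_action (v * w) \<alpha> = conj_action v (conj_action w \<alpha>)"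
  by (simp add: fun_eq_iff conj_action_def star_mult ad_mult)

lemma star_hom_comp: "star_hom \<phi> \<Longrightarrow> star_hom \<psi> \<Longrightarrow> star_hom (\<lambda>x. \<phi> (\<psi> x))"
  by (simp add: star_hom_def)

lemma is_action_conj:
  assumes \<alpha>: "is_action G \<alpha>" and w: "unitary w"
  shows "is_action G (conj_action w \<alpha>)"
  unfolding is_action_def
proof (intro conjI ballI allI)
  fix g assume "g \<in> carrier G"
  then show "star_hom (conj_action w \<alpha> g)"
    using star_hom_comp[OF star_hom_ad[OF w] star_hom_comp[OF _ star_hom_ad[OF unitary_star[OF w]]]]
      \<alpha> unfolding is_action_def conj_action_def[abs_def] by blast
qed (use assms in \<open>simp_all add: is_action_def conj_action_def ad_ad_star ad_star_ad\<close>)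

text \<open>
  Extending \<open>\<alpha>\<^sub>g\<close> to the unitization, \<open>z = \<alpha>\<^sub>g w\<close> is a unitary, and
  \<open>Ad w \<circ> \<alpha>\<^sub>g \<circ> (Ad w)\<^sup>-\<^sup>1 = Ad (w z\<^sup>*) \<circ> \<alpha>\<^sub>g\<close>: conjugating changes \<open>\<alpha>\<^sub>g\<close> only by an inner automorphism.
\<close>

lemma conj_approx_unitarily_equiv:
  assumes \<alpha>: "star_hom (\<alpha> g)" and w: "unitary w" and equiv: "\<alpha> g \<sim>\<^sub>a\<^sub>u \<beta> g"
  shows "conj_action w \<alpha> g \<sim>\<^sub>a\<^sub>u \<beta> g"
  unfolding approx_unitarily_equiv_iff_ad
proof (intro allI impI)
  fix F :: "'a set" and \<epsilon> :: real assume "finite F \<and> 0 < \<epsilon>"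
  then obtain u where u: "unitary u" "\<forall>a\<in>F. norm (ad u (\<alpha> g a) - \<beta> g a) < \<epsilon>"
    using equiv unfolding approx_unitarily_equiv_iff_ad by blast
  define z where "z = unitization_map (\<alpha> g) w"
  note hom = star_hom_unitization_map[OF \<alpha>]
  have z: "unitary z"
    using w hom(2) unfolding unitary_def z_def
    by (metis star_hom_mult[OF hom(1)] star_hom_star[OF hom(1)])
  have embed: "uni_embed (\<alpha> g y) = unitization_map (\<alpha> g) (uni_embed y)" for y
    by (simp add: unitization_map_def)
  have "\<alpha> g (ad (star w) a) = ad (star z) (\<alpha> g a)" for a
    by (rule uni_embed_eqI)
      (simp only: embed uni_embed_ad star_hom_mult[OF hom(1)] star_hom_star[OF hom(1)] z_def)
  then have "ad (u * z * star w) (conj_action w \<alpha> g a) = ad u (\<alpha> g a)" for a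
    by (simp add: conj_action_def ad_mult ad_star_ad w ad_ad_star z)
  with u z w show "\<exists>u. unitary u \<and> (\<forall>a\<in>F. norm (ad u (conj_action w \<alpha> g a) - \<beta> g a) < \<epsilon>)"
    by (intro exI[of _ "u * z * star w"]) (simp add: unitary_mult unitary_star)
qed

section \<open>Approximately central partitions of unity\<close>

text \<open>
  What remains of Rokhlin elements if the group action is forgotten: an orthogonal partition of unity,
  which commutes with every element and sums to the identity in the limit.
\<close>

locale approx_partition =
  fixes I :: "'g set" and r :: "'g \<Rightarrow> nat \<Rightarrow> 'a::cstar_algebra"
  assumes finite_I: "finite I"
    and norm_le_1: "h \<in> I \<Longrightarrow> norm (r h n) \<le> 1"
    and selfadjoint: "h \<in> I \<Longrightarrow> star (r h n) = r h n"
    and orthogonal: "h \<in> I \<Longrightarrow> k \<in> I \<Longrightarrow> h \<noteq> k \<Longrightarrow> r h n * r k n = 0"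
    and central: "h \<in> I \<Longrightarrow> (\<lambda>n. r h n * a) \<simeq> (\<lambda>n. a * r h n)"
    and total: "(\<lambda>n. (\<Sum>h\<in>I. r h n) * a) \<simeq> (\<lambda>n. a)"
begin

text \<open>
  In the limit \<open>r\<close> acts like a family of orthogonal central projections with sum \<open>1\<close>, and \<open>blend b\<close>
  glues the pieces \<open>b h\<close> together along it. The lemmas below say that \<open>blend\<close> is asymptotically a
  star-homomorphism from the product of copies of the algebra indexed by \<open>I\<close>.
\<close>

definition blend :: "('g \<Rightarrow> 'a) \<Rightarrow> nat \<Rightarrow> 'a"
  where "blend b n = (\<Sum>h\<in>I. r h n * b h)"

lemma Bseq_r: "h \<in> I \<Longrightarrow> Bseq (r h)"
  by (rule BseqI'[where K = 1]) (rule norm_le_1)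

lemma norm_blend_le:
  assumes "\<And>h. h \<in> I \<Longrightarrow> norm (b h) \<le> K"
  shows "norm (blend b n) \<le> real (card I) * K"
proof -
  have "norm (r h n * b h) \<le> K" if "h \<in> I" for h
  proof -
    have "norm (r h n * b h) \<le> 1 * K"
      by (rule order_trans[OF norm_mult_ineq], intro mult_mono)
        (use that assms norm_le_1 in auto)
    then show ?thesis by simp
  qed
  then show ?thesis unfolding blend_def by (rule sum_norm_bound)
qed

lemma Bseq_blend: "Bseq (blend b)"
proof (rule BseqI')
  fix n
  show "norm (blend b n) \<le> real (card I) * (\<Sum>h\<in>I. norm (b h))"
    by (rule norm_blend_le) (rule member_le_sum, auto simp: finite_I)
qed

lemma blend_add: "blend b n + blend c n = blend (\<lambda>h. b h + c h) n"
  by (simp add: blend_def distrib_left sum.distrib)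

lemma blend_diff: "blend b n - blend c n = blend (\<lambda>h. b h - c h) n"
  by (simp add: blend_def right_diff_distrib sum_subtractf)

lemma blend_mult_right: "blend b n * x = blend (\<lambda>h. b h * x) n"
  by (simp add: blend_def sum_distrib_right mult.assoc)

lemma blend_cong: "(\<And>h. h \<in> I \<Longrightarrow> b h = c h) \<Longrightarrow> blend b = blend c"
  by (simp add: blend_def fun_eq_iff)

lemma blend_const: "blend (\<lambda>h. c) \<simeq> (\<lambda>n. c)"
  using total[of c] by (simp add: blend_def[abs_def] sum_distrib_right)

text \<open>
  In \<open>r\<^sub>h ((\<Sum>\<^sub>k r\<^sub>k) a)\<close> orthogonality leaves only the term \<open>r\<^sub>h r\<^sub>h a\<close>, while the sum acts on \<open>a\<close> as
  the identity in the limit. So \<open>r\<^sub>h\<close> acts as a projection on every fixed element, though \<open>r\<^sub>h\<^sup>2\<close> need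
  not be close to \<open>r\<^sub>h\<close> in norm.
\<close>

lemma r_idempotent:
  assumes h: "h \<in> I"
  shows "(\<lambda>n. r h n * (r h n * a)) \<simeq> (\<lambda>n. r h n * a)"
proof -
  have "r h n * ((\<Sum>k\<in>I. r k n) * a) = r h n * (r h n * a)" for n
  proof -
    have "r h n * ((\<Sum>k\<in>I. r k n) * a) = (\<Sum>k\<in>I. r h n * r k n * a)"
      by (simp add: sum_distrib_left sum_distrib_right mult.assoc)
    also have "\<dots> = (\<Sum>k\<in>I. if k = h then r h n * r h n * a else 0)"
      using h by (intro sum.cong) (auto simp: orthogonal)
    finally show ?thesis using h finite_I by (simp add: mult.assoc)
  qed
  then show ?thesis
    using asymp_mult_left[OF Bseq_r[OF h] total[of a]] by simp
qed

text \<open>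
  In the double sum \<open>r\<^sub>h b\<^sub>h r\<^sub>k c\<^sub>k\<close>, centrality moves \<open>r\<^sub>k\<close> next to \<open>r\<^sub>h\<close>; the terms with \<open>h \<noteq> k\<close> vanish
  by orthogonality and the others are handled by \<open>r_idempotent\<close>.
\<close>

lemma blend_mult: "(\<lambda>n. blend b n * blend c n) \<simeq> blend (\<lambda>h. b h * c h)"
proof -
  have "(\<lambda>n. r h n * b h * (r k n * c k)) \<simeq> (\<lambda>n. if k = h then r h n * (b h * c h) else 0)"
    if h: "h \<in> I" and k: "k \<in> I" for h k
  proof -
    have "(\<lambda>n. r h n * (b h * r k n) * c k) \<simeq> (\<lambda>n. r h n * (r k n * b h) * c k)"
      by (intro asymp_mult_right asymp_mult_left Bseq_r h asymp_sym[OF central] k Bfun_const)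
    also have "\<dots> \<simeq> (\<lambda>n. if k = h then r h n * (b h * c h) else 0)"
    proof (cases "k = h")
      case True
      then show ?thesis using r_idempotent[OF h, of "b h * c h"] by (simp add: mult.assoc)
    next
      case False
      then show ?thesis using orthogonal[OF h k] by (simp flip: mult.assoc)
    qed
    finally show ?thesis by (simp add: mult.assoc)
  qed
  then have "(\<lambda>n. \<Sum>h\<in>I. \<Sum>k\<in>I. r h n * b h * (r k n * c k))
      \<simeq> (\<lambda>n. \<Sum>h\<in>I. \<Sum>k\<in>I. if k = h then r h n * (b h * c h) else 0)"
    by (intro asymp_sum)
  then show ?thesis
    by (simp add: blend_def[abs_def] sum_product finite_I)
qed

lemma blend_star: "(\<lambda>n. star (blend b n)) \<simeq> blend (\<lambda>h. star (b h))"
proof -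
  have "star (blend b n) = (\<Sum>h\<in>I. star (b h) * r h n)" for n
    by (simp add: blend_def star_sum star_mult selfadjoint)
  then show ?thesis
    unfolding blend_def[abs_def] by (simp add: asymp_sum asymp_sym[OF central])
qed

lemma asymp_uni_embed: "X \<simeq> Y \<Longrightarrow> (\<lambda>n. uni_embed (X n :: 'a)) \<simeq> (\<lambda>n. uni_embed (Y n))"
  unfolding asymp_eq_def
  by (subst tendsto_norm_zero_iff[symmetric])
    (simp add: norm_uni_embed tendsto_norm_zero flip: uni_embed_diff)

text \<open>
  Blending \<open>1 + a\<^sub>h\<close> directly would give \<open>\<Sum>\<^sub>h r\<^sub>h (1 + a\<^sub>h)\<close>, which is far from unitary in the
  unitization, where \<open>\<Sum>\<^sub>h r\<^sub>h\<close> does not approach \<open>1\<close>. Blending only the algebra parts and adding the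
  unit afterwards avoids this: \<open>v = 1 + \<Sum>\<^sub>h r\<^sub>h a\<^sub>h\<close> is almost unitary because unitarity of
  \<open>1 + a\<^sub>h\<close> amounts to the relations \<open>a\<^sup>* + a + a\<^sup>* a = 0 = a\<^sup>* + a + a a\<^sup>*\<close>, which blending preserves.
\<close>

lemma unital_blended_unitaries:
  assumes u: "\<And>h. h \<in> I \<Longrightarrow> unitary (Unitization (a h) 1)"
  obtains w where "\<And>n. unitary (w n)"
    "\<And>x. (\<lambda>n. ad (w n) x) \<simeq> blend (\<lambda>h. ad (Unitization (a h) 1) x)"
proof -
  define s v where "s = blend a" and "v n = Unitization (s n) 1" for n
  have s': "(\<lambda>n. star (s n)) \<simeq> blend (\<lambda>h. star (a h))"
    unfolding s_def by (rule blend_star)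
  have Bs: "Bseq s" "Bseq (\<lambda>n. star (s n))"
    using Bseq_blend[of a] by (simp_all add: s_def Bseq_def norm_star)
  have a1: "star (a h) + a h + star (a h) * a h = 0"
    and a2: "star (a h) + a h + a h * star (a h) = 0" if "h \<in> I" for h
    using u[OF that] by (simp_all add: unitary_def unitization_star_defs scaleC_one add_ac)
  have zero: "blend c = (\<lambda>n. 0)" if "\<And>h. h \<in> I \<Longrightarrow> c h = 0" for c
    using that by (simp add: blend_def fun_eq_iff)
  have "(\<lambda>n. star (s n) + s n + star (s n) * s n)
      \<simeq> (\<lambda>n. blend (\<lambda>h. star (a h)) n + blend a n + blend (\<lambda>h. star (a h) * a h) n)"
    by (intro asymp_add s' asymp_trans[OF asymp_mult[OF Bs(2) _ s'] blend_mult])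
      (simp_all add: s_def Bseq_blend)
  also have "\<dots> \<simeq> (\<lambda>n. 0)" by (simp add: blend_add zero a1)
  finally have vv1: "(\<lambda>n. star (v n) * v n) \<simeq> (\<lambda>n. 1)"
    using asymp_uni_embed[of _ "\<lambda>n. 0"]
    by (simp add: asymp_eq_def v_def unitization_star_defs scaleC_one add_ac)
  have "(\<lambda>n. star (s n) + s n + s n * star (s n))
      \<simeq> (\<lambda>n. blend (\<lambda>h. star (a h)) n + blend a n + blend (\<lambda>h. a h * star (a h)) n)"
    by (intro asymp_add s' asymp_trans[OF asymp_mult[OF Bs(1) _ _ s'] blend_mult])
      (simp_all add: s_def Bseq_blend)
  also have "\<dots> \<simeq> (\<lambda>n. 0)" by (simp add: blend_add zero a2)
  finally have vv2: "(\<lambda>n. v n * star (v n)) \<simeq> (\<lambda>n. 1)"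
    using asymp_uni_embed[of _ "\<lambda>n. 0"]
    by (simp add: asymp_eq_def v_def unitization_star_defs scaleC_one add_ac)
  obtain w where w: "\<And>n. unitary (w n)" "w \<simeq> v"
    by (rule asymp_unitaries[OF vv1 vv2]) (rule that)
  have Bw: "Bseq w" "Bseq (\<lambda>n. star (w n))"
    by (auto intro!: BseqI'[where K = 1] simp: norm_unitary w norm_star)
  have "Bseq v"
  proof -
    obtain K where "\<And>n. norm (s n) \<le> K" using Bs(1) by (auto simp: Bseq_def)
    then have "norm (v n) \<le> K + 1" for n
      using norm_unitization_le[of "v n"] by (simp add: v_def) (meson add_right_mono order_trans)
    then show ?thesis by (rule BseqI')
  qed
  then have Bv: "Bseq (\<lambda>n. star (v n))" by (simp add: Bseq_def norm_star)
  have ws: "(\<lambda>n. star (w n)) \<simeq> (\<lambda>n. star (v n))"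
    by (rule asymp_bounded_linear[OF bounded_linear_star w(2)])
  have "(\<lambda>n. ad (w n) x) \<simeq> blend (\<lambda>h. ad (Unitization (a h) 1) x)" for x
  proof -
    have "(\<lambda>n. w n * uni_embed x * star (w n)) \<simeq> (\<lambda>n. v n * uni_embed x * star (v n))"
    proof -
      have "(\<lambda>n. w n * (uni_embed x * star (w n))) \<simeq> (\<lambda>n. w n * (uni_embed x * star (v n)))"
        by (intro asymp_mult_left Bw Bfun_const ws)
      also have "(\<lambda>n. w n * (uni_embed x * star (v n))) = (\<lambda>n. w n * uni_embed x * star (v n))"
        by (simp add: mult.assoc)
      also have "\<dots> \<simeq> (\<lambda>n. v n * uni_embed x * star (v n))"
        by (intro asymp_mult_right Bv Bfun_const w(2))
      finally show ?thesis by (simp add: mult.assoc)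
    qed
    then have "(\<lambda>n. ad (w n) x) \<simeq> (\<lambda>n. ad (v n) x)"
      unfolding ad_def by (rule asymp_bounded_linear[OF bounded_linear_uni_alg])
    also have "(\<lambda>n. ad (v n) x) = (\<lambda>n. x + s n * x + x * star (s n) + s n * x * star (s n))"
      by (simp add: fun_eq_iff ad_def v_def unitization_star_defs scaleC_one scaleC_zero_left
          algebra_simps)
    also have "\<dots> \<simeq> (\<lambda>n. blend (\<lambda>h. x) n + blend (\<lambda>h. a h * x) n + blend (\<lambda>h. x * star (a h)) n
        + blend (\<lambda>h. a h * x * star (a h)) n)"
    proof (intro asymp_add)
      show "(\<lambda>n. x) \<simeq> blend (\<lambda>h. x)" by (rule asymp_sym[OF blend_const])
      have sx: "s n * x = blend (\<lambda>h. a h * x) n" for n by (simp add: s_def blend_mult_right)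
      then show "(\<lambda>n. s n * x) \<simeq> blend (\<lambda>h. a h * x)" by simp
      show "(\<lambda>n. x * star (s n)) \<simeq> blend (\<lambda>h. x * star (a h))"
        by (rule asymp_trans[OF asymp_mult[OF Bfun_const _ asymp_sym[OF blend_const] s'] blend_mult])
          (rule Bseq_blend)
      show "(\<lambda>n. s n * x * star (s n)) \<simeq> blend (\<lambda>h. a h * x * star (a h))"
        unfolding sx by (rule asymp_trans[OF asymp_mult_left[OF Bseq_blend s'] blend_mult])
    qed
    also have "\<dots> = blend (\<lambda>h. ad (Unitization (a h) 1) x)"
      by (simp add: fun_eq_iff blend_add ad_def unitization_star_defs scaleC_one
          scaleC_zero_left algebra_simps)
    ultimately show ?thesis by simp
  qed
  with w(1) show thesis by (rule that)
qed

text \<open>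
  The scalar part \<open>c\<close> of a unitary has modulus \<open>1\<close>, so dividing by it makes the scalar part \<open>1\<close> and
  does not change the inner automorphism.
\<close>

lemma blended_unitaries:
  assumes u: "\<And>h. h \<in> I \<Longrightarrow> unitary (u h)"
  obtains w where "\<And>n. unitary (w n)" "\<And>x. (\<lambda>n. ad (w n) x) \<simeq> blend (\<lambda>h. ad (u h) x)"
proof -
  define c a where "c h = cnj (uni_scal (u h))" and "a h = c h *\<^sub>C uni_alg (u h)" for h
  have c: "c h * cnj (c h) = 1" "c h * uni_scal (u h) = 1" if "h \<in> I" for h
    using u[OF that]
    by (simp_all add: unitary_def c_def unitization_star_defs unitization.expand mult.commute)
  have cu: "Unitization (a h) 1 = c h *\<^sub>C u h" if "h \<in> I" for h
    using c[OF that] by (simp add: a_def scaleC_unitization_def)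
  have unit: "unitary (Unitization (a h) 1)" if "h \<in> I" for h
    using u[OF that] c[OF that] unfolding cu[OF that]
    by (simp add: unitary_def star_scaleC mult_scaleC_left mult_scaleC_right scaleC_scaleC
        scaleC_one mult.commute)
  have ad: "ad (Unitization (a h) 1) x = ad (u h) x" if "h \<in> I" for h x
    using c[OF that] unfolding cu[OF that]
    by (simp add: ad_def star_scaleC mult_scaleC_left mult_scaleC_right scaleC_scaleC
        scaleC_one mult.commute)
  have eq: "blend (\<lambda>h. ad (Unitization (a h) 1) x) = blend (\<lambda>h. ad (u h) x)" for x
    by (rule blend_cong) (rule ad)
  show thesis
    by (rule unital_blended_unitaries[of a]) (erule unit, rule that, simp_all only: eq)
qed

end


section \<open>Rokhlin sequences\<close>

definition Rokhlin_sequence ::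
    "('g, 'm) monoid_scheme \<Rightarrow> ('g \<Rightarrow> 'a::cstar_algebra \<Rightarrow> 'a) \<Rightarrow> ('g \<Rightarrow> nat \<Rightarrow> 'a) \<Rightarrow> bool"
  where "Rokhlin_sequence G \<alpha> r \<longleftrightarrow> approx_partition (carrier G) r \<and>
    (\<forall>g\<in>carrier G. \<forall>h\<in>carrier G. (\<lambda>n. \<alpha> g (r h n)) \<simeq> r (g \<otimes>\<^bsub>G\<^esub> h))"

lemma separable_dense_sequence:
  assumes "separable_space (euclidean :: 'a::topological_space topology)"
  obtains d :: "nat \<Rightarrow> 'a::topological_space" where "closure (range d) = UNIV"
proof -
  obtain C :: "'a set" where C: "countable C" "closure C = UNIV"
    using assms by (auto simp: separable_space_def)
  then have "C \<noteq> {}" by auto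
  with C(1) have "range (from_nat_into C) = C" by (rule range_from_nat_into[rotated])
  with C(2) that show thesis by metis
qed

text \<open>
  For larger and larger finite parts of a dense sequence and tolerances \<open>1 / (n + 1)\<close> the Rokhlin
  property gives elements whose limiting behaviour extends from the dense sequence to all elements, since the maps
  \<open>a \<mapsto> r a - a r\<close> and \<open>a \<mapsto> (\<Sum>\<^sub>h r\<^sub>h) a - a\<close> are uniformly bounded.
\<close>

lemma Rokhlin_sequence_exists:
  fixes \<alpha> :: "'g \<Rightarrow> 'a::cstar_algebra \<Rightarrow> 'a"
  assumes G: "finite (carrier G)" and sep: "separable_space (euclidean :: 'a topology)"
    and Rokhlin: "Rokhlin_property G \<alpha>"
  obtains r where "Rokhlin_sequence G \<alpha> r"
proof -
  obtain d :: "nat \<Rightarrow> 'a" where d: "closure (range d) = UNIV"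
    using separable_dense_sequence[OF sep] .
  define Q where "Q n r \<longleftrightarrow>
      (\<forall>g\<in>carrier G. positive (r g) \<and> norm (r g) \<le> 1) \<and>
      (\<forall>g\<in>carrier G. \<forall>h\<in>carrier G. g \<noteq> h \<longrightarrow> r g * r h = 0) \<and>
      (\<forall>g\<in>carrier G. \<forall>h\<in>carrier G. norm (\<alpha> g (r h) - r (g \<otimes>\<^bsub>G\<^esub> h)) < inverse (Suc n)) \<and>
      (\<forall>a\<in>d ` {..n}. \<forall>g\<in>carrier G. norm (r g * a - a * r g) < inverse (Suc n)) \<and>
      (\<forall>a\<in>d ` {..n}. norm ((\<Sum>g\<in>carrier G. r g) * a - a) < inverse (Suc n))"
    for n and r :: "'g \<Rightarrow> 'a"
  have "\<exists>r. Q n r" for n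
    unfolding Q_def
    by (rule Rokhlin[unfolded Rokhlin_property_def, THEN spec, THEN spec, THEN mp]) simp
  then obtain r0 :: "nat \<Rightarrow> 'g \<Rightarrow> 'a" where Q: "\<And>n. Q n (r0 n)" by metis
  have r0: "g \<in> carrier G \<Longrightarrow> star (r0 n g) = r0 n g \<and> norm (r0 n g) \<le> 1"
      "g \<in> carrier G \<Longrightarrow> h \<in> carrier G \<Longrightarrow> g \<noteq> h \<Longrightarrow> r0 n g * r0 n h = 0"
      "g \<in> carrier G \<Longrightarrow> h \<in> carrier G \<Longrightarrow>
        norm (\<alpha> g (r0 n h) - r0 n (g \<otimes>\<^bsub>G\<^esub> h)) < inverse (Suc n)"
      "g \<in> carrier G \<Longrightarrow> i \<le> n \<Longrightarrow> norm (r0 n g * d i - d i * r0 n g) < inverse (Suc n)"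
      "i \<le> n \<Longrightarrow> norm ((\<Sum>g\<in>carrier G. r0 n g) * d i - d i) < inverse (Suc n)" for n g h i
    using Q[of n] unfolding Q_def positive_def by simp_all
  define r where "r g n = r0 n g" for g n
  have null: "X \<longlonglongrightarrow> 0" if "\<And>n. n \<ge> i \<Longrightarrow> norm (X n) < inverse (Suc n)" for X :: "nat \<Rightarrow> 'a" and i
    by (rule Lim_null_comparison[OF _ LIMSEQ_inverse_real_of_nat])
      (use that in \<open>auto simp: eventually_sequentially intro!: exI[of _ i] less_imp_le\<close>)
  have "approx_partition (carrier G) r"
  proof
    fix h and a :: 'a assume h: "h \<in> carrier G"
    have "(\<lambda>n. r h n * a - a * r h n) \<longlonglongrightarrow> 0"
    proof (rule dense_tendsto_zero[OF _ _ d])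
      show "linear (\<lambda>a. r h n * a - a * r h n)" for n
        by (intro bounded_linear.linear bounded_linear_sub bounded_linear_mult_right
            bounded_linear_mult_left)
      show "norm (r h n * a - a * r h n) \<le> 2 * norm a" for n a
      proof -
        have "norm (r h n * a - a * r h n) \<le> norm (r h n) * norm a + norm a * norm (r h n)"
          by (intro order_trans[OF norm_triangle_ineq4] add_mono norm_mult_ineq)
        also have "\<dots> \<le> 1 * norm a + norm a * 1"
          using r0(1)[OF h] unfolding r_def by (intro add_mono mult_mono) auto
        finally show ?thesis by simp
      qed
      show "(\<lambda>n. r h n * a - a * r h n) \<longlonglongrightarrow> 0" if a: "a \<in> range d" for a
      proof -
        obtain i where i: "a = d i" using a by blast
        show ?thesis unfolding r_def i by (intro null[of i] r0(4)[OF h])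
      qed
    qed
    then show "(\<lambda>n. r h n * a) \<simeq> (\<lambda>n. a * r h n)" by (simp add: asymp_eq_def)
  next
    fix a :: 'a
    let ?s = "\<lambda>n. \<Sum>h\<in>carrier G. r h n"
    have "(\<lambda>n. ?s n * a - a) \<longlonglongrightarrow> 0"
    proof (rule dense_tendsto_zero[OF _ _ d])
      show "linear (\<lambda>a. ?s n * a - a)" for n
        by (intro bounded_linear.linear bounded_linear_sub bounded_linear_mult_right
            bounded_linear_ident)
      show "norm (?s n * a - a) \<le> (real (card (carrier G)) * 1 + 1) * norm a" for n a
      proof -
        have "norm (?s n) \<le> real (card (carrier G)) * 1"
          using r0(1) unfolding r_def by (intro sum_norm_bound) auto
        then have "norm (?s n) * norm a \<le> real (card (carrier G)) * 1 * norm a"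
          by (rule mult_right_mono) simp
        then show ?thesis
          using norm_triangle_ineq4[of "?s n * a" a] norm_mult_ineq[of "?s n" a]
          by (simp add: algebra_simps)
      qed
      show "(\<lambda>n. ?s n * a - a) \<longlonglongrightarrow> 0" if a: "a \<in> range d" for a
      proof -
        obtain i where i: "a = d i" using a by blast
        show ?thesis unfolding r_def i by (intro null[of i] r0(5))
      qed
    qed
    then show "(\<lambda>n. ?s n * a) \<simeq> (\<lambda>n. a)" by (simp add: asymp_eq_def)
  qed (use G r0 in \<open>auto simp: r_def\<close>)
  moreover have "(\<lambda>n. \<alpha> g (r h n)) \<simeq> r (g \<otimes>\<^bsub>G\<^esub> h)" if "g \<in> carrier G" "h \<in> carrier G" for g h
    unfolding asymp_eq_def r_def by (rule null[of 0]) (use r0(3)[OF that] in auto)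
  ultimately show thesis using that unfolding Rokhlin_sequence_def by blast
qed

lemma Rokhlin_sequence_conj:
  assumes r: "Rokhlin_sequence G \<alpha> r" and w: "unitary w"
  shows "Rokhlin_sequence G (conj_action w \<alpha>) (\<lambda>g n. ad w (r g n))"
proof -
  interpret approx_partition "carrier G" r using r by (simp add: Rokhlin_sequence_def)
  note hom = star_hom_ad[OF w]
  note mult = star_hom_mult[OF hom, symmetric] and star = star_hom_star[OF hom, symmetric]
    and limit = asymp_bounded_linear[OF star_hom_bounded_linear[OF hom]]
  have a: "a = ad w (ad (star w) a)" for a by (simp add: ad_ad_star w)
  have "approx_partition (carrier G) (\<lambda>g n. ad w (r g n))"
  proof
    show "(\<lambda>n. ad w (r h n) * a) \<simeq> (\<lambda>n. a * ad w (r h n))" if "h \<in> carrier G" for h a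
      by (subst (1 2) a) (simp add: mult limit central that)
    show "(\<lambda>n. (\<Sum>h\<in>carrier G. ad w (r h n)) * a) \<simeq> (\<lambda>n. a)" for a
      by (subst (1 2) a) (simp add: mult star_hom_sum[OF hom, symmetric] limit[OF total])
    show "ad w (r h n) * ad w (r k n) = 0"
      if "h \<in> carrier G" "k \<in> carrier G" "h \<noteq> k" for h k n
      using orthogonal[OF that] by (simp add: mult star_hom_zero[OF hom])
  qed (use norm_le_1 selfadjoint finite_I in \<open>simp_all add: norm_ad w star\<close>)
  moreover have "(\<lambda>n. conj_action w \<alpha> g (ad w (r h n))) \<simeq> (\<lambda>n. ad w (r (g \<otimes>\<^bsub>G\<^esub> h) n))"
    if "g \<in> carrier G" "h \<in> carrier G" for g h
    unfolding conj_action_ad[OF w]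
    by (rule limit) (use r that in \<open>simp add: Rokhlin_sequence_def\<close>)
  ultimately show ?thesis unfolding Rokhlin_sequence_def by blast
qed

text \<open>
  Equivariance: \<open>\<alpha>\<^sub>g\<close> sends \<open>r\<^sub>h\<close> to \<open>r\<^sub>g\<^sub>h\<close>, so the blended family is translated by \<open>g\<close>.
\<close>

lemma (in group) blend_action:
  assumes "is_action G \<alpha>" "Rokhlin_sequence G \<alpha> r" and g: "g \<in> carrier G"
  shows "(\<lambda>n. \<alpha> g (approx_partition.blend (carrier G) r b n))
    \<simeq> approx_partition.blend (carrier G) r (\<lambda>k. \<alpha> g (b (inv g \<otimes> k)))"
proof -
  interpret approx_partition "carrier G" r using assms(2) by (simp add: Rokhlin_sequence_def)
  have hom: "star_hom (\<alpha> g)" using assms by (simp add: is_action_def)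
  have "\<alpha> g (blend b n) = (\<Sum>h\<in>carrier G. \<alpha> g (r h n) * \<alpha> g (b h))" for n
    by (simp add: blend_def star_hom_sum[OF hom] star_hom_mult[OF hom])
  moreover have "(\<lambda>n. \<Sum>h\<in>carrier G. \<alpha> g (r h n) * \<alpha> g (b h))
      \<simeq> (\<lambda>n. \<Sum>h\<in>carrier G. r (g \<otimes> h) n * \<alpha> g (b h))"
    using assms(2) g
    by (intro asymp_sum asymp_mult_right Bfun_const) (simp add: Rokhlin_sequence_def)
  moreover have "(\<lambda>n. \<Sum>h\<in>carrier G. r (g \<otimes> h) n * \<alpha> g (b h)) = blend (\<lambda>k. \<alpha> g (b (inv g \<otimes> k)))"
  proof
    fix n
    show "(\<Sum>h\<in>carrier G. r (g \<otimes> h) n * \<alpha> g (b h)) = blend (\<lambda>k. \<alpha> g (b (inv g \<otimes> k))) n"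
      unfolding blend_def
      by (rule sum.reindex_bij_witness[of _ "\<lambda>k. inv g \<otimes> k" "\<lambda>h. g \<otimes> h"])
        (use g in \<open>simp_all flip: m_assoc\<close>)
  qed
  ultimately show ?thesis by simp
qed

section \<open>One step of the intertwining\<close>

lemma (in group) action_simps:
  assumes "is_action G \<alpha>" "g \<in> carrier G" "h \<in> carrier G"
  shows "\<alpha> g (\<alpha> h x) = \<alpha> (g \<otimes> h) x" "\<alpha> \<one> x = x"
  using assms by (simp_all add: is_action_def)

text \<open>
  The unitaries \<open>u\<^sub>h\<close> realise \<open>Ad u\<^sub>h \<circ> \<alpha>\<^sub>h \<approx> \<beta>\<^sub>h\<close>, and \<open>w\<close> is obtained by blending them along a Rokhlin
  sequence of \<open>\<beta>\<close>, so that \<open>Ad w x\<close> is close to the blend of \<open>\<beta>\<^sub>h (\<alpha>\<^sub>h\<^sup>-\<^sup>1 x)\<close>. Applying \<open>\<beta>\<^sub>g\<close> gives the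
  blend of \<open>\<beta>\<^sub>k (\<alpha>\<^sub>k\<^sup>-\<^sup>1 (\<alpha>\<^sub>g x))\<close>, with \<open>k = g h\<close>, and this is close to \<open>Ad w (\<alpha>\<^sub>g x)\<close>. The last
  conclusion is the crucial extra: \<open>w\<close> nearly commutes with every \<open>x\<close> on which the two actions already
  nearly agree, because then \<open>\<beta>\<^sub>h (\<alpha>\<^sub>h\<^sup>-\<^sup>1 x) \<approx> x\<close> for all \<open>h\<close>. The factor \<open>card (carrier G)\<close> is the
  triangle inequality for the blend.
\<close>

lemma (in group) Rokhlin_intertwining_unitary:
  fixes \<epsilon> :: real
  assumes \<alpha>: "is_action G \<alpha>" and \<beta>: "is_action G \<beta>"
    and r: "Rokhlin_sequence G \<beta> r" and equiv: "\<forall>g\<in>carrier G. \<alpha> g \<sim>\<^sub>a\<^sub>u \<beta> g"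
    and E: "finite E" and \<epsilon>: "\<epsilon> > 0"
  obtains w where "unitary w"
    "\<forall>x\<in>E. \<forall>g\<in>carrier G. norm (ad w (\<alpha> g x) - \<beta> g (ad w x)) \<le> \<epsilon>"
    "\<And>x (\<delta> :: real). x \<in> E \<Longrightarrow> \<forall>g\<in>carrier G. norm (\<alpha> g x - \<beta> g x) \<le> \<delta> \<Longrightarrow>
      norm (ad w x - x) \<le> card (carrier G) * \<delta> + \<epsilon>"
proof -
  interpret approx_partition "carrier G" r using r by (simp add: Rokhlin_sequence_def)
  define N where "N = real (card (carrier G))"
  have N: "N > 0" using finite_I by (auto simp: N_def card_gt_0_iff)
  \<comment> \<open>A blend of \<open>N\<close> terms, each off by at most \<open>2 * \<eta>\<close>, is off by at most \<open>\<epsilon> / 2\<close>; the other half of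
    \<open>\<epsilon>\<close> absorbs the passage to the limit.\<close>
  define \<eta> where "\<eta> = \<epsilon> / (4 * N)"
  have \<eta>: "\<eta> > 0" "N * \<eta> = \<epsilon> / 4" using N \<epsilon> by (simp_all add: \<eta>_def)
  define Z where "Z = (\<Union>k\<in>carrier G. \<alpha> k ` E)"
  have "finite Z" unfolding Z_def using finite_I E by blast
  then have "\<exists>u. unitary u \<and> (\<forall>a\<in>Z. norm (ad u (\<alpha> h a) - \<beta> h a) < \<eta>)" if "h \<in> carrier G" for h
    using equiv that \<eta>(1) unfolding approx_unitarily_equiv_iff_ad by blast
  then obtain u where u: "\<And>h. h \<in> carrier G \<Longrightarrow> unitary (u h)"
      "\<And>h a. h \<in> carrier G \<Longrightarrow> a \<in> Z \<Longrightarrow> norm (ad (u h) (\<alpha> h a) - \<beta> h a) < \<eta>"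
    by metis
  have u\<beta>: "norm (ad (u h) (\<alpha> (h \<otimes> k) x) - \<beta> h (\<alpha> k x)) \<le> \<eta>"
    if "h \<in> carrier G" "k \<in> carrier G" "x \<in> E" for h k x
    using u(2)[of h "\<alpha> k x"] that action_simps(1)[OF \<alpha>] by (force simp: Z_def)
  obtain w where w: "\<And>n. unitary (w n)" "\<And>x. (\<lambda>n. ad (w n) x) \<simeq> blend (\<lambda>h. ad (u h) x)"
    using blended_unitaries[of u] u(1) by blast
  define moves where "moves x = (SUP g\<in>carrier G. norm (\<alpha> g x - \<beta> g x))" for x
  have le_moves: "norm (\<alpha> g x - \<beta> g x) \<le> moves x" if "g \<in> carrier G" for g x
    unfolding moves_def by (rule cSUP_upper) (use that finite_I in auto)
  have commute: "\<forall>\<^sub>F n in sequentially. norm (ad (w n) x - x) \<le> N * moves x + \<epsilon>"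
    if x: "x \<in> E" for x
  proof -
    have "norm (ad (u h) x - x) \<le> \<eta> + moves x" if h: "h \<in> carrier G" for h
    proof -
      have hom: "star_hom (\<beta> h)" using \<beta> h by (simp add: is_action_def)
      have "norm (ad (u h) x - \<beta> h (\<alpha> (inv h) x)) \<le> \<eta>"
        using u\<beta>[OF h inv_closed[OF h] x] h \<alpha> by (simp add: is_action_def)
      moreover have "\<beta> h (\<alpha> (inv h) x) - x = \<beta> h (\<alpha> (inv h) x - \<beta> (inv h) x)"
        using h \<beta> by (simp add: star_hom_diff[OF hom] action_simps[OF \<beta>])
      then have "norm (\<beta> h (\<alpha> (inv h) x) - x) \<le> moves x"
        using star_hom_contractive[OF hom] le_moves[OF inv_closed[OF h]] by (metis order_trans)
      ultimately show ?thesis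
        using norm_triangle_ineq[of "ad (u h) x - \<beta> h (\<alpha> (inv h) x)" "\<beta> h (\<alpha> (inv h) x) - x"]
        by simp
    qed
    then have "norm (blend (\<lambda>h. ad (u h) x - x) n) \<le> N * (\<eta> + moves x)" for n
      unfolding N_def by (rule norm_blend_le)
    moreover have "(\<lambda>n. ad (w n) x - x) \<simeq> blend (\<lambda>h. ad (u h) x - x)"
      using asymp_diff[OF w(2) asymp_sym[OF blend_const]] by (simp add: blend_diff)
    ultimately have "\<forall>\<^sub>F n in sequentially. norm (ad (w n) x - x) \<le> N * (\<eta> + moves x) + \<epsilon> / 2"
      using \<epsilon> by (intro asymp_eventually_norm_le) auto
    then show ?thesis
      by eventually_elim (use \<epsilon> \<eta> in \<open>simp add: distrib_left\<close>)
  qed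
  have intertwine: "\<forall>\<^sub>F n in sequentially. norm (ad (w n) (\<alpha> g x) - \<beta> g (ad (w n) x)) \<le> \<epsilon>"
    if g: "g \<in> carrier G" and x: "x \<in> E" for g x
  proof -
    have hom: "star_hom (\<beta> g)" using \<beta> g by (simp add: is_action_def)
    let ?d = "\<lambda>k. ad (u k) (\<alpha> g x) - \<beta> g (ad (u (inv g \<otimes> k)) x)"
    \<comment> \<open>Both terms of \<open>?d k\<close> are within \<open>\<eta>\<close> of \<open>\<beta>\<^sub>k (\<alpha>\<^sub>k\<^sup>-\<^sup>1 (\<alpha>\<^sub>g x))\<close>.\<close>
    have "norm (?d k) \<le> 2 * \<eta>" if k: "k \<in> carrier G" for k
    proof -
      let ?h = "inv g \<otimes> k" and ?y = "\<alpha> (inv k \<otimes> g) x"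
      have k': "k \<otimes> (inv k \<otimes> g) = g" and "g \<otimes> ?h = k"
        using g k by (simp_all flip: m_assoc)
      moreover have "?h \<otimes> (inv k \<otimes> g) = \<one>"
        using g k by (simp add: m_assoc k')
      ultimately have 1: "norm (ad (u k) (\<alpha> g x) - \<beta> k ?y) \<le> \<eta>"
        and "norm (ad (u ?h) x - \<beta> ?h ?y) \<le> \<eta>" and 2: "\<beta> g (\<beta> ?h ?y) = \<beta> k ?y"
        using u\<beta>[of k "inv k \<otimes> g" x] u\<beta>[of ?h "inv k \<otimes> g" x] g k x \<alpha> \<beta>
        by (simp_all add: is_action_def[of G \<alpha>] action_simps(1)[OF \<beta>])
      then have "norm (\<beta> g (ad (u ?h) x - \<beta> ?h ?y)) \<le> \<eta>"
        using star_hom_contractive[OF hom] order_trans by blast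
      then have "norm (\<beta> g (ad (u ?h) x) - \<beta> k ?y) \<le> \<eta>"
        by (simp only: star_hom_diff[OF hom] 2)
      with 1 show ?thesis
        using norm_triangle_ineq4[of "ad (u k) (\<alpha> g x) - \<beta> k ?y" "\<beta> g (ad (u ?h) x) - \<beta> k ?y"]
        by simp
    qed
    then have "norm (blend ?d n) \<le> N * (2 * \<eta>)" for n
      unfolding N_def by (rule norm_blend_le)
    moreover have "(\<lambda>n. \<beta> g (ad (w n) x)) \<simeq> blend (\<lambda>k. \<beta> g (ad (u (inv g \<otimes> k)) x))"
      using asymp_bounded_linear[OF star_hom_bounded_linear[OF hom] w(2)] blend_action[OF \<beta> r g]
      by (rule asymp_trans)
    then have "(\<lambda>n. ad (w n) (\<alpha> g x) - \<beta> g (ad (w n) x)) \<simeq> blend ?d"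
      unfolding blend_diff[symmetric] by (intro asymp_diff w(2))
    ultimately have "\<forall>\<^sub>F n in sequentially.
        norm (ad (w n) (\<alpha> g x) - \<beta> g (ad (w n) x)) \<le> N * (2 * \<eta>) + \<epsilon> / 2"
      using \<epsilon> by (intro asymp_eventually_norm_le) auto
    then show ?thesis by eventually_elim (use \<eta> in simp)
  qed
  have "\<forall>\<^sub>F n in sequentially. (\<forall>x\<in>E. norm (ad (w n) x - x) \<le> N * moves x + \<epsilon>) \<and>
      (\<forall>x\<in>E. \<forall>g\<in>carrier G. norm (ad (w n) (\<alpha> g x) - \<beta> g (ad (w n) x)) \<le> \<epsilon>)"
    using commute intertwine finite_I E
    by (intro eventually_conj eventually_ball_finite ballI) auto
  then obtain n where n: "\<forall>x\<in>E. norm (ad (w n) x - x) \<le> N * moves x + \<epsilon>"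
      "\<forall>x\<in>E. \<forall>g\<in>carrier G. norm (ad (w n) (\<alpha> g x) - \<beta> g (ad (w n) x)) \<le> \<epsilon>"
    by (auto simp: eventually_sequentially)
  show thesis
  proof (rule that[OF w(1) n(2)])
    fix x \<delta> assume x: "x \<in> E" and \<delta>: "\<forall>g\<in>carrier G. norm (\<alpha> g x - \<beta> g x) \<le> \<delta>"
    have "moves x \<le> \<delta>"
      unfolding moves_def by (rule cSUP_least) (use \<delta> in auto)
    then have "N * moves x \<le> N * \<delta>" using N by simp
    then show "norm (ad (w n) x - x) \<le> card (carrier G) * \<delta> + \<epsilon>"
      using n(1) x unfolding N_def by fastforce
  qed
qed

text \<open>
  With the Rokhlin sequence of \<open>\<beta>\<close>, the previous lemma makes the conjugated action close to \<open>\<beta>\<close> on the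
  image \<open>ad v ` E\<close>; with that of \<open>\<alpha>\<close>, the roles exchanged and the unitary inverted, on \<open>E\<close> itself.
  Convergence of \<open>Ad w\<^sub>n\<close> needs the former, convergence of the inverses the latter. Doing first the one
  and then the other achieves both: the second unitary almost commutes with \<open>ad v ` E\<close>, where the
  actions already agree up to \<open>\<kappa>\<close>, and so does not destroy what the first has gained.
\<close>

lemma (in group) approx_conjugating_unitary:
  fixes \<epsilon> :: real
  assumes \<alpha>: "is_action G \<alpha>" and \<beta>: "is_action G \<beta>"
    and r: "Rokhlin_sequence G \<alpha> r" and s: "Rokhlin_sequence G \<beta> s"
    and equiv: "\<forall>g\<in>carrier G. \<alpha> g \<sim>\<^sub>a\<^sub>u \<beta> g"
    and E: "finite E" and \<epsilon>: "\<epsilon> > 0"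
  obtains w where "unitary w"
    "\<forall>x\<in>E \<union> ad w ` E. \<forall>g\<in>carrier G. norm (conj_action w \<alpha> g x - \<beta> g x) \<le> \<epsilon>"
    "\<And>x (\<delta> :: real). x \<in> E \<Longrightarrow> \<forall>g\<in>carrier G. norm (\<alpha> g x - \<beta> g x) \<le> \<delta> \<Longrightarrow>
      norm (ad w x - x) \<le> card (carrier G) * \<delta> + \<epsilon>"
proof -
  define N where "N = real (card (carrier G))"
  \<comment> \<open>The estimate on \<open>ad w ` E\<close> adds up to \<open>\<kappa> + 2 * (N * \<kappa> + \<kappa>)\<close>.\<close>
  define \<kappa> where "\<kappa> = \<epsilon> / (2 * N + 3)"
  have N: "N \<ge> 0" by (simp add: N_def)
  have "\<kappa> * (2 * N + 3) = \<epsilon>" using N by (simp add: \<kappa>_def)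
  then have \<kappa>: "2 * (N * \<kappa>) + 3 * \<kappa> = \<epsilon>" by (simp add: algebra_simps)
  have \<kappa>0: "\<kappa> > 0" using \<epsilon> N by (simp add: \<kappa>_def)
  have N\<kappa>: "N * \<kappa> \<ge> 0" using N \<kappa>0 by simp
  obtain v where v: "unitary v"
      and v1: "\<forall>x\<in>E. \<forall>g\<in>carrier G. norm (ad v (\<alpha> g x) - \<beta> g (ad v x)) \<le> \<kappa>"
      and v2: "\<And>x (\<delta> :: real). x \<in> E \<Longrightarrow> \<forall>g\<in>carrier G. norm (\<alpha> g x - \<beta> g x) \<le> \<delta> \<Longrightarrow>
        norm (ad v x - x) \<le> N * \<delta> + \<kappa>"
    by (rule Rokhlin_intertwining_unitary[OF \<alpha> \<beta> s equiv E \<kappa>0, folded N_def]) (rule that)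
  define \<alpha>' where "\<alpha>' = conj_action v \<alpha>"
  have near: "norm (\<alpha>' g (ad v x) - \<beta> g (ad v x)) \<le> \<kappa>" if "x \<in> E" "g \<in> carrier G" for x g
    using v1 that by (simp add: \<alpha>'_def conj_action_ad v)
  have equiv': "\<forall>g\<in>carrier G. \<beta> g \<sim>\<^sub>a\<^sub>u \<alpha>' g"
    unfolding \<alpha>'_def using \<alpha> equiv v
    by (intro ballI approx_unitarily_equiv_sym[OF conj_approx_unitarily_equiv])
      (auto simp: is_action_def)
  have \<alpha>': "is_action G \<alpha>'" and r': "Rokhlin_sequence G \<alpha>' (\<lambda>g n. ad v (r g n))"
    unfolding \<alpha>'_def by (intro is_action_conj \<alpha> v, intro Rokhlin_sequence_conj r v)
  have fin: "finite (E \<union> ad v ` E)" using E by simp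
  obtain z where z: "unitary z"
      and z1: "\<forall>x\<in>E \<union> ad v ` E. \<forall>g\<in>carrier G. norm (ad z (\<beta> g x) - \<alpha>' g (ad z x)) \<le> \<kappa>"
      and z2: "\<And>x (\<delta> :: real). x \<in> E \<union> ad v ` E \<Longrightarrow> \<forall>g\<in>carrier G. norm (\<beta> g x - \<alpha>' g x) \<le> \<delta> \<Longrightarrow>
        norm (ad z x - x) \<le> N * \<delta> + \<kappa>"
    by (rule Rokhlin_intertwining_unitary[OF \<beta> \<alpha>' r' equiv' fin \<kappa>0, folded N_def]) (rule that)
  define w where "w = star z * v"
  have w: "unitary w" by (simp add: w_def unitary_mult unitary_star v z)
  have near1: "norm (conj_action w \<alpha> g x - \<beta> g x) \<le> \<kappa>"
    if "x \<in> E \<union> ad v ` E" "g \<in> carrier G" for x g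
  proof -
    have "conj_action w \<alpha> g x = ad (star z) (\<alpha>' g (ad z x))"
      by (simp add: w_def conj_action_mult \<alpha>'_def) (simp add: conj_action_def star_star)
    then have "norm (conj_action w \<alpha> g x - \<beta> g x) = norm (ad z (\<beta> g x) - \<alpha>' g (ad z x))"
      using norm_diff_ad_star[OF z] by (simp add: norm_minus_commute)
    then show ?thesis using z1 that by simp
  qed
  have close: "norm (ad w x - ad v x) \<le> N * \<kappa> + \<kappa>" if "x \<in> E" for x
  proof -
    have "norm (ad z (ad v x) - ad v x) \<le> N * \<kappa> + \<kappa>"
      using near that by (intro z2) (auto simp: norm_minus_commute)
    then show ?thesis
      using norm_diff_ad_star[OF z, of "ad v x" "ad v x"]
      by (simp add: w_def ad_mult norm_minus_commute)
  qed
  show thesis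
  proof (rule that[OF w])
    show "\<forall>x\<in>E \<union> ad w ` E. \<forall>g\<in>carrier G. norm (conj_action w \<alpha> g x - \<beta> g x) \<le> \<epsilon>"
    proof (intro ballI)
      fix x g assume "x \<in> E \<union> ad w ` E" and g: "g \<in> carrier G"
      then consider "x \<in> E" | y where "y \<in> E" "x = ad w y" by blast
      then show "norm (conj_action w \<alpha> g x - \<beta> g x) \<le> \<epsilon>"
      proof cases
        case 1
        then show ?thesis using near1[of x g] g \<kappa> \<kappa>0 N\<kappa> by simp
      next
        case 2
        have hom: "star_hom (conj_action w \<alpha> g)" "star_hom (\<beta> g)"
          using is_action_conj[OF \<alpha> w] \<beta> g by (simp_all add: is_action_def)
        let ?e = "x - ad v y"
        have e: "norm ?e \<le> N * \<kappa> + \<kappa>" using close[OF 2(1)] by (simp add: 2(2))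
        have "conj_action w \<alpha> g x - \<beta> g x = (conj_action w \<alpha> g (ad v y) - \<beta> g (ad v y))
            + (conj_action w \<alpha> g ?e - \<beta> g ?e)"
          by (simp add: star_hom_diff[OF hom(1)] star_hom_diff[OF hom(2)])
        also have "norm \<dots> \<le> norm (conj_action w \<alpha> g (ad v y) - \<beta> g (ad v y))
            + (norm (conj_action w \<alpha> g ?e) + norm (\<beta> g ?e))"
          by (intro order_trans[OF norm_triangle_ineq] add_left_mono norm_triangle_ineq4)
        also have "\<dots> \<le> \<kappa> + ((N * \<kappa> + \<kappa>) + (N * \<kappa> + \<kappa>))"
          using star_hom_contractive[OF hom(1), of ?e] star_hom_contractive[OF hom(2), of ?e] e
          by (intro add_mono near1) (use 2 g in auto)
        finally show ?thesis using \<kappa> by simp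
      qed
    qed
  next
    fix x \<delta> assume x: "x \<in> E" and \<delta>: "\<forall>g\<in>carrier G. norm (\<alpha> g x - \<beta> g x) \<le> \<delta>"
    have "norm (ad w x - x) \<le> norm (ad w x - ad v x) + norm (ad v x - x)"
      using norm_triangle_ineq[of "ad w x - ad v x" "ad v x - x"] by simp
    also have "\<dots> \<le> (N * \<kappa> + \<kappa>) + (N * \<delta> + \<kappa>)"
      by (intro add_mono close v2 x \<delta>)
    finally show "norm (ad w x - x) \<le> card (carrier G) * \<delta> + \<epsilon>"
      using \<kappa> \<kappa>0 N\<kappa> by (simp flip: N_def)
  qed
qed

section \<open>Passing to the limit\<close>

lemma convergent_on_dense:
  fixes \<phi> :: "nat \<Rightarrow> 'a::real_normed_vector \<Rightarrow> 'b::banach"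
  assumes lin: "\<And>n. linear (\<phi> n)" and bound: "\<And>n x. norm (\<phi> n x) \<le> norm x"
    and dense: "closure D = UNIV" and conv: "\<And>x. x \<in> D \<Longrightarrow> convergent (\<lambda>n. \<phi> n x)"
  shows "convergent (\<lambda>n. \<phi> n x)"
proof -
  have "Cauchy (\<lambda>n. \<phi> n x)"
  proof (rule metric_CauchyI)
    fix \<epsilon> :: real assume \<epsilon>: "0 < \<epsilon>"
    obtain y where y: "y \<in> D" "norm (x - y) < \<epsilon> / 3"
      using dense \<epsilon> by (metis UNIV_I closure_approachable dist_commute dist_norm
          divide_pos_pos zero_less_numeral)
    obtain M where M: "dist (\<phi> m y) (\<phi> n y) < \<epsilon> / 3" if "m \<ge> M" "n \<ge> M" for m n
      using metric_CauchyD[OF convergent_Cauchy[OF conv[OF y(1)]], of "\<epsilon> / 3"] \<epsilon> by auto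
    have near: "dist (\<phi> n x) (\<phi> n y) < \<epsilon> / 3" for n
      using bound[of n "x - y"] y(2) by (simp add: dist_norm linear_diff[OF lin])
    have "dist (\<phi> m x) (\<phi> n x) < \<epsilon>" if "m \<ge> M" "n \<ge> M" for m n
      using M[OF that] near[of m] near[of n] by metric
    then show "\<exists>M. \<forall>m\<ge>M. \<forall>n\<ge>M. dist (\<phi> m x) (\<phi> n x) < \<epsilon>" by blast
  qed
  then show ?thesis by (rule Cauchy_convergent)
qed

lemma convergent_geometric_steps:
  fixes X :: "nat \<Rightarrow> 'a::banach"
  assumes "\<And>n. n > m \<Longrightarrow> norm (X (Suc n) - X n) \<le> C * (1/2) ^ n"
  shows "convergent X"
proof -
  have "summable (\<lambda>n. C * (1/2::real) ^ n)" by (intro summable_mult summable_geometric) simp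
  then have "summable (\<lambda>n. X (Suc n) - X n)"
    by (rule summable_comparison_test[rotated]) (use assms in \<open>auto intro!: exI[of _ "Suc m"]\<close>)
  then have "convergent (\<lambda>n. \<Sum>k<n. X (Suc k) - X k)" by (simp add: summable_iff_convergent)
  then have "convergent (\<lambda>n. X n - X 0)" by (simp add: sum_lessThan_telescope)
  then show ?thesis by (simp add: convergent_diff_const_right_iff)
qed

lemma star_hom_limit:
  assumes "\<And>n. star_hom (\<phi> n)" and \<psi>: "\<And>x. (\<lambda>n. \<phi> n x) \<longlonglongrightarrow> \<psi> x"
  shows "star_hom \<psi>"
  unfolding star_hom_def
proof (intro conjI allI)
  show "\<psi> (x + y) = \<psi> x + \<psi> y" for x y
    by (rule LIMSEQ_unique[OF \<psi>]) (simp add: star_hom_add assms(1) tendsto_add \<psi>)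
  show "\<psi> (c *\<^sub>C x) = c *\<^sub>C \<psi> x" for c x
    by (rule LIMSEQ_unique[OF \<psi>])
      (simp add: star_hom_scaleC assms(1) bounded_linear.tendsto[OF bounded_linear_scaleC_right] \<psi>)
  show "\<psi> (x * y) = \<psi> x * \<psi> y" for x y
    by (rule LIMSEQ_unique[OF \<psi>]) (simp add: star_hom_mult assms(1) tendsto_mult \<psi>)
  show "\<psi> (star x) = star (\<psi> x)" for x
    by (rule LIMSEQ_unique[OF \<psi>]) (simp add: star_hom_star assms(1) tendsto_star \<psi>)
qed

lemma limits_of_inverses:
  assumes "\<And>n. linear (\<phi> n)" "\<And>n x. norm (\<phi> n x) \<le> norm x" "\<And>n x. \<phi> n (\<xi> n x) = x"
    and "\<And>x. (\<lambda>n. \<phi> n x) \<longlonglongrightarrow> \<phi>' x" "\<And>x. (\<lambda>n. \<xi> n x) \<longlonglongrightarrow> \<xi>' x"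
  shows "\<phi>' (\<xi>' x) = x"
proof (rule LIMSEQ_unique[OF assms(4)])
  have "(\<lambda>n. \<phi> n (\<xi>' x) - x) \<longlonglongrightarrow> 0"
  proof (rule Lim_null_comparison)
    show "\<forall>\<^sub>F n in sequentially. norm (\<phi> n (\<xi>' x) - x) \<le> norm (\<xi>' x - \<xi> n x)"
    proof (intro always_eventually allI)
      fix n
      have "norm (\<phi> n (\<xi>' x - \<xi> n x)) \<le> norm (\<xi>' x - \<xi> n x)" by (rule assms(2))
      then show "norm (\<phi> n (\<xi>' x) - x) \<le> norm (\<xi>' x - \<xi> n x)"
        by (simp add: linear_diff[OF assms(1)] assms(3))
    qed
    show "(\<lambda>n. norm (\<xi>' x - \<xi> n x)) \<longlonglongrightarrow> 0"
      using tendsto_norm_zero[OF LIM_zero[OF assms(5)]] by (simp add: norm_minus_commute)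
  qed
  then show "(\<lambda>n. \<phi> n (\<xi>' x)) \<longlonglongrightarrow> x" by (rule LIM_zero_cancel)
qed

text \<open>
  At stage \<open>n\<close> the conjugated action is within \<open>2\<^sup>-\<^sup>n\<close> of \<open>\<beta>\<close> on \<open>d\<^sub>i\<close> and \<open>Ad w\<^sub>n d\<^sub>i\<close> for \<open>i < n\<close> (the set
  \<open>S n w\<close>). Hence the next correction moves these elements by a multiple of \<open>2\<^sup>-\<^sup>n\<close>: on \<open>Ad w\<^sub>n d\<^sub>i\<close> this
  controls the step from \<open>Ad w\<^sub>n\<close> to \<open>Ad w\<^sub>n\<^sub>+\<^sub>1\<close>, and on \<open>d\<^sub>i\<close> the step between the inverses.
\<close>

lemma (in group) conjugating_unitary_sequence:
  fixes d :: "nat \<Rightarrow> 'c::cstar_algebra"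
  assumes \<alpha>: "is_action G \<alpha>" and \<beta>: "is_action G \<beta>"
    and r: "Rokhlin_sequence G \<alpha> r" and s: "Rokhlin_sequence G \<beta> s"
    and equiv: "\<forall>g\<in>carrier G. \<alpha> g \<sim>\<^sub>a\<^sub>u \<beta> g"
  obtains w C where "\<And>n. unitary (w n)"
    "\<And>(n :: nat) i g. i < n \<Longrightarrow> g \<in> carrier G \<Longrightarrow>
      norm (ad (w n) (\<alpha> g (d i)) - \<beta> g (ad (w n) (d i))) \<le> (1/2) ^ n"
    "\<And>(n :: nat) i. i < n \<Longrightarrow> norm (ad (w (Suc n)) (d i) - ad (w n) (d i)) \<le> C * (1/2) ^ n"
    "\<And>(n :: nat) i. i < n \<Longrightarrow> norm (ad (star (w (Suc n))) (d i) - ad (star (w n)) (d i)) \<le> C * (1/2) ^ n"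
proof -
  define N where "N = real (card (carrier G))"
  define S where "S n w = d ` {..<n} \<union> ad w ` d ` {..<n}" for n w
  define P where "P n w \<longleftrightarrow> unitary w \<and>
    (\<forall>x\<in>S n w. \<forall>g\<in>carrier G. norm (conj_action w \<alpha> g x - \<beta> g x) \<le> (1/2) ^ n)" for n w
  define Q where "Q n w w' \<longleftrightarrow>
    (\<forall>x\<in>S n w. norm (ad (w' * star w) x - x) \<le> (N + 1) * (1/2) ^ n)" for n w w'
  have "P 0 1" by (simp add: P_def S_def unitary_one)
  moreover have "\<exists>w'. P (Suc n) w' \<and> Q n w w'" if P: "P n w" for n w
  proof -
    have w: "unitary w" using P by (simp add: P_def)
    have equiv': "\<forall>g\<in>carrier G. conj_action w \<alpha> g \<sim>\<^sub>a\<^sub>u \<beta> g"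
      using \<alpha> equiv w by (auto simp: is_action_def intro: conj_approx_unitarily_equiv)
    have fin: "finite (S (Suc n) w)" by (simp add: S_def)
    have half_pow: "0 < (1/2 :: real) ^ Suc n" by simp
    obtain v where v: "unitary v"
      and v1: "\<forall>x\<in>S (Suc n) w \<union> ad v ` S (Suc n) w. \<forall>g\<in>carrier G.
        norm (conj_action v (conj_action w \<alpha>) g x - \<beta> g x) \<le> (1/2) ^ Suc n"
      and v2: "\<And>x (\<delta> :: real). x \<in> S (Suc n) w \<Longrightarrow>
        \<forall>g\<in>carrier G. norm (conj_action w \<alpha> g x - \<beta> g x) \<le> \<delta> \<Longrightarrow>
        norm (ad v x - x) \<le> N * \<delta> + (1/2) ^ Suc n"
      by (rule approx_conjugating_unitary[OF is_action_conj[OF \<alpha> w] \<beta> Rokhlin_sequence_conj[OF r w]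
          s equiv' fin half_pow, folded N_def]) (rule that)
    have "P (Suc n) (v * w)"
      using v1 unitary_mult[OF v w]
      by (auto simp: P_def conj_action_mult S_def ad_mult)
    moreover have "v * w * star w = v"
      using w by (simp add: unitary_def mult.assoc)
    have "Q n w (v * w)"
      unfolding Q_def \<open>v * w * star w = v\<close>
    proof
      fix x assume x: "x \<in> S n w"
      have "norm (ad v x - x) \<le> N * (1/2) ^ n + (1/2) ^ Suc n"
        using x P by (intro v2) (auto simp: S_def P_def)
      then show "norm (ad v x - x) \<le> (N + 1) * (1/2) ^ n"
        by (rule order_trans) (simp add: distrib_right)
    qed
    ultimately show ?thesis by blast
  qed
  ultimately obtain w where w: "\<And>n. P n (w n)" "\<And>n. Q n (w n) (w (Suc n))"
    using dependent_nat_choice[of P Q] by blast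
  have u: "unitary (w n)" for n using w(1) by (simp add: P_def)
  show thesis
  proof (rule that[OF u])
    fix n i :: nat and g assume i: "i < n" and g: "g \<in> carrier G"
    have "ad (w n) (d i) \<in> S n (w n)" using i by (auto simp: S_def)
    then have "norm (conj_action (w n) \<alpha> g (ad (w n) (d i)) - \<beta> g (ad (w n) (d i))) \<le> (1/2) ^ n"
      using w(1) g by (simp add: P_def)
    then show "norm (ad (w n) (\<alpha> g (d i)) - \<beta> g (ad (w n) (d i))) \<le> (1/2) ^ n"
      by (simp add: conj_action_ad u)
  next
    fix n i :: nat assume i: "i < n"
    have x: "ad (w n) (d i) \<in> S n (w n)" "d i \<in> S n (w n)" using i by (auto simp: S_def)
    show "norm (ad (w (Suc n)) (d i) - ad (w n) (d i)) \<le> (N + 1) * (1/2) ^ n"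
      using w(2)[of n, unfolded Q_def, rule_format, OF x(1)] by (simp add: ad_mult ad_star_ad u)
    have "norm (ad (star (w (Suc n))) (d i) - ad (star (w n)) (d i))
        = norm (ad (w (Suc n)) (ad (star (w n)) (d i)) - d i)"
      using norm_diff_ad_star[OF u, of "ad (star (w n)) (d i)" "Suc n" "d i"]
      by (simp add: norm_minus_commute)
    then show "norm (ad (star (w (Suc n))) (d i) - ad (star (w n)) (d i)) \<le> (N + 1) * (1/2) ^ n"
      using w(2)[of n] x(2) by (simp add: Q_def ad_mult)
  qed
qed

text \<open>
  The limit \<open>\<psi>\<close> of the \<open>Ad w\<^sub>n\<close> is bijective because the limit \<open>\<xi>\<close> of their inverses is inverse to it,
  and approximately inner as a pointwise limit of inner automorphisms. It intertwines the actions
  because the defect \<open>Ad w\<^sub>n \<circ> \<alpha>\<^sub>g - \<beta>\<^sub>g \<circ> Ad w\<^sub>n\<close> tends to zero on a dense set.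
\<close>

theorem theorem3p4:
  fixes G :: "('g, 'm) monoid_scheme"
    and \<alpha> \<beta> :: "'g \<Rightarrow> 'a::cstar_algebra \<Rightarrow> 'a"
  assumes "group G" and "finite (carrier G)"
    and "separable_space (euclidean :: 'a topology)"
    and "\<alpha> \<in> hom G Aut" and "\<beta> \<in> hom G Aut"
    and "Rokhlin_property G \<alpha>" and "Rokhlin_property G \<beta>"
    and "\<forall>g\<in>carrier G. \<alpha> g \<sim>\<^sub>a\<^sub>u \<beta> g"
  shows "\<exists>\<psi> \<in> carrier Aut. approx_inner \<psi> \<and> (\<forall>g\<in>carrier G. \<psi> \<circ> \<alpha> g = \<beta> g \<circ> \<psi>)"
proof -
  interpret group G by fact
  have \<alpha>: "is_action G \<alpha>" and \<beta>: "is_action G \<beta>"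
    using assms by (simp_all add: is_action_hom_Aut)
  obtain r where r: "Rokhlin_sequence G \<alpha> r"
    using Rokhlin_sequence_exists[OF assms(2,3,6)] .
  obtain s where s: "Rokhlin_sequence G \<beta> s"
    using Rokhlin_sequence_exists[OF assms(2,3,7)] .
  obtain d :: "nat \<Rightarrow> 'a" where d: "closure (range d) = UNIV"
    using separable_dense_sequence[OF assms(3)] .
  obtain w C where u: "\<And>n. unitary (w n)"
    and near: "\<And>(n :: nat) i g. i < n \<Longrightarrow> g \<in> carrier G \<Longrightarrow>
      norm (ad (w n) (\<alpha> g (d i)) - \<beta> g (ad (w n) (d i))) \<le> (1/2) ^ n"
    and steps: "\<And>(n :: nat) i. i < n \<Longrightarrow> norm (ad (w (Suc n)) (d i) - ad (w n) (d i)) \<le> C * (1/2) ^ n"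
      "\<And>(n :: nat) i. i < n \<Longrightarrow> norm (ad (star (w (Suc n))) (d i) - ad (star (w n)) (d i)) \<le> C * (1/2) ^ n"
    by (rule conjugating_unitary_sequence[OF \<alpha> \<beta> r s assms(8), of d]) (rule that)
  note u' = unitary_star[OF u]
  have lin: "linear (ad v)" if "unitary v" for v :: "'a unitization"
    by (intro bounded_linear.linear star_hom_bounded_linear star_hom_ad that)
  have "convergent (\<lambda>n. ad (w n) (d i))" "convergent (\<lambda>n. ad (star (w n)) (d i))" for i
    using steps[of i] by (auto intro!: convergent_geometric_steps[of i _ C])
  then have conv: "x \<in> range d \<Longrightarrow> convergent (\<lambda>n. ad (w n) x)"
      "x \<in> range d \<Longrightarrow> convergent (\<lambda>n. ad (star (w n)) x)" for x
    by auto
  have "convergent (\<lambda>n. ad (w n) x)" for x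
    by (rule convergent_on_dense[OF lin[OF u] _ d conv(1)]) (simp_all add: norm_ad u)
  then obtain \<psi> where \<psi>: "\<And>x. (\<lambda>n. ad (w n) x) \<longlonglongrightarrow> \<psi> x"
    unfolding convergent_def by metis
  have "convergent (\<lambda>n. ad (star (w n)) x)" for x
    by (rule convergent_on_dense[OF lin[OF u'] _ d conv(2)]) (simp_all add: norm_ad u')
  then obtain \<xi> where \<xi>: "\<And>x. (\<lambda>n. ad (star (w n)) x) \<longlonglongrightarrow> \<xi> x"
    unfolding convergent_def by metis
  have "\<psi> (\<xi> x) = x" for x
    by (rule limits_of_inverses[OF lin[OF u] _ _ \<psi> \<xi>]) (simp_all add: norm_ad u ad_ad_star)
  moreover have "\<xi> (\<psi> x) = x" for x
    by (rule limits_of_inverses[OF lin[OF u'] _ _ \<xi> \<psi>]) (simp_all add: norm_ad u' u ad_star_ad)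
  ultimately have "bij \<psi>" by (intro o_bij[of \<xi> \<psi>]) auto
  moreover have hom: "star_hom \<psi>"
    by (rule star_hom_limit[OF star_hom_ad[OF u] \<psi>])
  ultimately have "\<psi> \<in> carrier Aut" by (simp add: Aut_def)
  moreover have "approx_inner \<psi>"
    unfolding approx_inner_def
  proof (rule approx_unitarily_equiv_sym, unfold approx_unitarily_equiv_iff_ad, intro allI impI)
    fix F :: "'a set" and \<epsilon> :: real assume F: "finite F \<and> 0 < \<epsilon>"
    then have "\<forall>\<^sub>F n in sequentially. \<forall>a\<in>F. dist (ad (w n) a) (\<psi> a) < \<epsilon>"
      by (intro eventually_ball_finite ballI tendstoD \<psi>) auto
    then obtain n where "\<forall>a\<in>F. dist (ad (w n) a) (\<psi> a) < \<epsilon>"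
      by (auto simp: eventually_sequentially)
    then show "\<exists>v. unitary v \<and> (\<forall>a\<in>F. norm (ad v (id a) - \<psi> a) < \<epsilon>)"
      using u by (auto simp: dist_norm)
  qed
  moreover have "\<psi> \<circ> \<alpha> g = \<beta> g \<circ> \<psi>" if g: "g \<in> carrier G" for g
  proof
    fix x
    have hom: "star_hom (\<alpha> g)" "star_hom (\<beta> g)"
      using \<alpha> \<beta> g by (simp_all add: is_action_def)
    note contr = star_hom_contractive[OF hom(1)] star_hom_contractive[OF hom(2)]
    have lims: "(\<lambda>n. ad (w n) (\<alpha> g x) - \<beta> g (ad (w n) x)) \<longlonglongrightarrow> \<psi> (\<alpha> g x) - \<beta> g (\<psi> x)"
      by (rule tendsto_diff[OF \<psi> star_hom_tendsto[OF hom(2) \<psi>]])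
    have "(\<lambda>n. ad (w n) (\<alpha> g x) - \<beta> g (ad (w n) x)) \<longlonglongrightarrow> 0"
    proof (rule dense_tendsto_zero[OF _ _ d])
      show "linear (\<lambda>x. ad (w n) (\<alpha> g x) - \<beta> g (ad (w n) x))" for n
        by (intro bounded_linear.linear bounded_linear_sub star_hom_bounded_linear
            star_hom_comp[of "ad (w n)" "\<alpha> g"] star_hom_comp[of "\<beta> g" "ad (w n)"] hom
            star_hom_ad u)
      show "norm (ad (w n) (\<alpha> g x) - \<beta> g (ad (w n) x)) \<le> 2 * norm x" for n x
        using norm_triangle_ineq4[of "ad (w n) (\<alpha> g x)" "\<beta> g (ad (w n) x)"]
          contr(1)[of x] contr(2)[of "ad (w n) x"] by (simp add: norm_ad u)
      show "(\<lambda>n. ad (w n) (\<alpha> g x) - \<beta> g (ad (w n) x)) \<longlonglongrightarrow> 0" if "x \<in> range d" for x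
      proof -
        from that obtain i where i: "x = d i" by blast
        have "\<forall>\<^sub>F n in sequentially.
            norm (ad (w n) (\<alpha> g x) - \<beta> g (ad (w n) x)) \<le> (1/2) ^ n"
          using eventually_gt_at_top[of i] by eventually_elim (simp add: i near g)
        then show ?thesis by (rule Lim_null_comparison) (rule LIMSEQ_power_zero, simp)
      qed
    qed
    then have "\<psi> (\<alpha> g x) - \<beta> g (\<psi> x) = 0" by (rule LIMSEQ_unique[OF lims])
    then show "(\<psi> \<circ> \<alpha> g) x = (\<beta> g \<circ> \<psi>) x" by simp
  qed
  ultimately show ?thesis by blast
qed

end
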